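(* Let $G$ be the group of one of Constructions A–D in the context. (a) In Construction A, $\exp(G)=p$ or $p^2$, and the latter occurs if and only if $p=3$ and $S_1$ is not the zero map. (b) In Constructions B and C, $\exp(G)=p^2$ or $p^3$, and the latter occurs if and only if $p=3$ and the restriction of $S_1$ to $\mathbb{F}_{3^l}$ is not the zero map. (c) In Construction D, $\exp(G)=3^3$ or $3^4$, and the latter occurs if and only if the restriction of $S_1$ to $\mathbb{F}_{3^l}$ is not the zero map.
   Context: Let $q=p^m$, $p$ prime. A pair $(A,\sigma)$, $A\in\mathrm{GL}(4,q)$, $\sigma\in\mathrm{Aut}(\mathbb{F}_q)$, with product $(A_1,\sigma_1)\circ(A_2,\sigma_2)=(A_1^{\sigma_2}A_2,\sigma_1\sigma_2)$ ($A^\sigma$: $\sigma$ applied entrywise). $E(a,b,c,t)$ is the matrix with rows $(1,0,0,0),(-c,1,0,0),(b-ct,t,1,0),(a,b,c,1)$. Given $T$, $\theta$, put $\mathfrak{g}_{a,b,c}=(E(a,b,c,T(a,b,c)),\theta_{a,b,c})$ and $G_{T,\theta}=\{\mathfrak{g}_{a,b,c}\}$. $\mathrm{tr}=\mathrm{tr}_{\mathbb{F}_q/\mathbb{F}_p}$. Construction A: $\theta\equiv1$, $T(a,b,c)=S_1(c)$, $S_1(X)=\sum_{i=0}^{m-1}s_iX^{p^i}$ over $\mathbb{F}_q$; $G=G_{T,\theta}$. Construction B: $q=p^{pl}$, $p$ odd, $g(x)=x^{p^l}$; $S_1$ reduced linearized with coefficients in $\mathbb{F}_{p^l}$; $\mu_C\in\mathbb{F}_{p^l}^*$;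 $\theta_{a,b,c}=g^{\mathrm{tr}(\mu_Cc)}$, $T(a,b,c)=S_1(c)$; $G=G_{T,\theta}$. Construction C: $q=p^{pl}$, $p$ odd, $g(x)=x^{p^l}$; $\mu_B\in\mathbb{F}_{p^l}^*$; $s_i\in\mathbb{F}_{p^l}$ ($0\le i\le pl-1$) with $\mu_Bs_i-s_{pl-i}^{p^i}\mu_B^{p^i}=0$ for $1\le i\le pl-1$; $S_1=\sum s_iX^{p^i}$, $Q(x)=-\mathrm{tr}(\mu_BxS_1(x))$; $\theta_{a,b,c}=g^{\frac12Q(c)+\mathrm{tr}(\mu_Bb)}$, $T(a,b,c)=S_1(c)$; $G=G_{T,\theta}$. Construction D: $q=3^{9l}$, $g(x)=x^{3^l}$, $g_1=g^3$; $u\in\mathbb{F}_{3^{3l}}$ with $\mu_C=u-u^g\in\mathbb{F}_{3^l}^*$; $t_C$ with $\lambda_C=\mathrm{tr}_{\mathbb{F}_q/\mathbb{F}_3}(\mu_Ct_C)\ne0$; $\mu_B\in\mathbb{F}_{3^l}^*$; $s_i\in\mathbb{F}_{3^l}$ with $-\mu_Bs_i+s_{9l-i}^{3^i}\mu_B^{3^i}=\mu_Cu^{3^i}-u\mu_C^{3^i}$, $1\le i\le 9l-1$; $\alpha\in\mathbb{F}_{3^{3l}}$, $\lambda\in\mathbb{F}_3$ with $g(\alpha)-\alpha=\lambda_Cu+\lambda\mu_C$; $S_1=\sum s_iX^{3^i}$, $Q(x)=-\mathrm{tr}_{\mathbb{F}_q/\mathbb{F}_3}(\mu_BxS_1(x))$,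 $K=\{z:\mathrm{tr}_{\mathbb{F}_q/\mathbb{F}_3}(\mu_Cz)=0\}$; for $c\in K$, $\mathfrak{g}_{a,b,c}=(E(a,b,c,S_1(c)),g_1^{\frac12Q(c)+\mathrm{tr}_{\mathbb{F}_q/\mathbb{F}_3}(\alpha c+\mu_Bb)})$; $G=\langle\{\mathfrak{g}_{a,b,c}:c\in K\},(E(0,0,t_C,S_1(t_C)),g)\rangle$.
   Formalization: In (a) the "if and only if" is stated only for odd p: for p = 2 it fails, since a nonzero S_1 (e.g. q = 2, S_1(X) = X) gives exp(G) = 4 = p^2 although p is not 3; "exp(G) = p or p^2" is kept for every prime p. *)

theory Defs
  imports
    "HOL-Analysis.Analysis"
    "HOL-Algebra.Generated_Groups"
    "HOL-Computational_Algebra.Primes"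
begin

text \<open>
  The field with \<open>q\<close> elements is an arbitrary type \<open>'a\<close> of class \<open>finite_field\<close> with
  \<open>CARD('a) = q\<close>. For \<open>q = p ^ m\<close> and \<open>d\<close> dividing \<open>m\<close>, the subfield with \<open>p ^ d\<close> elements is
  \<open>subfld p d\<close>.
\<close>

definition subfld :: "nat \<Rightarrow> nat \<Rightarrow> 'a::finite_field set" where
  "subfld p d = {x. x ^ (p ^ d) = x}"

text \<open>The absolute trace, for \<open>CARD('a) = p ^ m\<close>.\<close>

definition tr :: "nat \<Rightarrow> nat \<Rightarrow> 'a::finite_field \<Rightarrow> 'a" where
  "tr p m x = (\<Sum>i<m. x ^ (p ^ i))"

text \<open>
  Elements of the prime field (such as values of \<open>tr\<close>) occur as exponents of automorphisms of
  order \<open>p\<close>; \<open>rep\<close> picks their representative in \<open>{0..<p}\<close>.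
\<close>

definition rep :: "'a::finite_field \<Rightarrow> nat" where
  "rep z = (LEAST n. of_nat n = z)"

definition lin_poly :: "nat \<Rightarrow> nat \<Rightarrow> (nat \<Rightarrow> 'a::finite_field) \<Rightarrow> 'a \<Rightarrow> 'a" where
  "lin_poly p m s x = (\<Sum>i<m. s i * x ^ (p ^ i))"

definition frob :: "nat \<Rightarrow> nat \<Rightarrow> 'a::finite_field \<Rightarrow> 'a" where
  "frob p l x = x ^ (p ^ l)"

definition field_auts :: "('a::field \<Rightarrow> 'a) set" where
  "field_auts = {\<sigma>. bij \<sigma> \<and> \<sigma> 1 = 1 \<and> (\<forall>x y. \<sigma> (x + y) = \<sigma> x + \<sigma> y) \<and> (\<forall>x y. \<sigma> (x * y) = \<sigma> x * \<sigma> y)}"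

definition map_mat :: "('a \<Rightarrow> 'a) \<Rightarrow> 'a^4^4 \<Rightarrow> 'a^4^4" where
  "map_mat \<sigma> A = (\<chi> i j. \<sigma> (A $ i $ j))"

text \<open>
  Automorphisms act on the right, so the product \<open>\<sigma>\<^sub>1\<sigma>\<^sub>2\<close> is the composition \<open>\<sigma>\<^sub>2 \<circ> \<sigma>\<^sub>1\<close>.
\<close>

definition GammaL4 :: "(('a::finite_field^4^4) \<times> ('a \<Rightarrow> 'a)) monoid" where
  "GammaL4 = \<lparr>carrier = {A. invertible A} \<times> field_auts,
     monoid.mult = (\<lambda>(A\<^sub>1, \<sigma>\<^sub>1) (A\<^sub>2, \<sigma>\<^sub>2). (map_mat \<sigma>\<^sub>2 A\<^sub>1 ** A\<^sub>2, \<sigma>\<^sub>2 \<circ> \<sigma>\<^sub>1)),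
     one = (mat 1, id)\<rparr>"

lemma map_mat_mult:
  assumes "\<sigma> \<in> field_auts"
  shows "map_mat \<sigma> (A ** B) = map_mat \<sigma> A ** map_mat \<sigma> (B :: 'a::field^4^4)"
  using assms by (simp add: field_auts_def map_mat_def matrix_matrix_mult_def vec_eq_iff sum_4)

lemma field_auts_zero: "\<sigma> \<in> field_auts \<Longrightarrow> \<sigma> 0 = 0"
  unfolding field_auts_def by (metis (mono_tags, lifting) add_cancel_right_right mem_Collect_eq)

lemma map_mat_one: "\<sigma> \<in> field_auts \<Longrightarrow> map_mat \<sigma> (mat 1) = mat 1"
  using field_auts_zero[of \<sigma>] by (simp add: field_auts_def map_mat_def mat_def vec_eq_iff)

lemma map_mat_comp: "map_mat \<sigma> (map_mat \<tau> A) = map_mat (\<sigma> \<circ> \<tau>) A"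
  by (simp add: map_mat_def)

lemma map_mat_id: "map_mat id A = A"
  by (simp add: map_mat_def)

lemma map_mat_invertible:
  assumes "\<sigma> \<in> field_auts" "invertible (A :: 'a::field^4^4)"
  shows "invertible (map_mat \<sigma> A)"
  using assms unfolding invertible_def by (metis map_mat_mult map_mat_one)

lemma field_auts_comp: "\<sigma> \<in> field_auts \<Longrightarrow> \<tau> \<in> field_auts \<Longrightarrow> \<sigma> \<circ> \<tau> \<in> field_auts"
  by (auto simp: field_auts_def bij_comp)

lemma field_auts_inv:
  assumes "\<sigma> \<in> field_auts"
  shows "inv_into UNIV \<sigma> \<in> field_auts"
proof -
  have b: "bij \<sigma>" using assms by (simp add: field_auts_def)
  have e: "inv_into UNIV \<sigma> z = w \<longleftrightarrow> z = \<sigma> w" for z w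
    using b by (metis bij_inv_eq_iff)
  have f: "\<sigma> (inv_into UNIV \<sigma> z) = z" for z
    using b by (metis bij_inv_eq_iff)
  show ?thesis
    using assms b by (auto simp: field_auts_def bij_imp_bij_inv e f)
qed

lemma group_GammaL4: "group (GammaL4 :: (('a::finite_field^4^4) \<times> ('a \<Rightarrow> 'a)) monoid)"
proof (rule groupI)
  fix x y :: "('a^4^4) \<times> ('a \<Rightarrow> 'a)"
  assume "x \<in> carrier GammaL4" "y \<in> carrier GammaL4"
  then show "x \<otimes>\<^bsub>GammaL4\<^esub> y \<in> carrier GammaL4"
    by (auto simp: GammaL4_def map_mat_invertible invertible_mult field_auts_comp)
next
  show "\<one>\<^bsub>GammaL4\<^esub> \<in> carrier (GammaL4 :: (('a^4^4) \<times> ('a \<Rightarrow> 'a)) monoid)"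
    by (auto simp: GammaL4_def field_auts_def invertible_def intro!: exI[of _ "mat 1"])
next
  fix x y z :: "('a^4^4) \<times> ('a \<Rightarrow> 'a)"
  assume "x \<in> carrier GammaL4" "y \<in> carrier GammaL4" "z \<in> carrier GammaL4"
  then show "x \<otimes>\<^bsub>GammaL4\<^esub> y \<otimes>\<^bsub>GammaL4\<^esub> z = x \<otimes>\<^bsub>GammaL4\<^esub> (y \<otimes>\<^bsub>GammaL4\<^esub> z)"
    by (auto simp: GammaL4_def map_mat_mult map_mat_comp matrix_mul_assoc comp_assoc)
next
  fix x :: "('a^4^4) \<times> ('a \<Rightarrow> 'a)"
  assume "x \<in> carrier GammaL4"
  then show "\<one>\<^bsub>GammaL4\<^esub> \<otimes>\<^bsub>GammaL4\<^esub> x = x"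
    by (auto simp: GammaL4_def map_mat_one)
next
  fix x :: "('a^4^4) \<times> ('a \<Rightarrow> 'a)"
  assume x: "x \<in> carrier GammaL4"
  obtain A \<sigma> where A: "x = (A, \<sigma>)" by fastforce
  have inv: "invertible A" "\<sigma> \<in> field_auts" using x A by (auto simp: GammaL4_def)
  obtain B where B: "A ** B = mat 1" "B ** A = mat 1"
    using inv by (auto simp: invertible_def)
  let ?\<tau> = "inv_into UNIV \<sigma>"
  have s: "\<sigma> \<circ> ?\<tau> = id"
    using inv by (auto simp: field_auts_def fun_eq_iff bij_is_surj surj_f_inv_f)
  have "invertible B" using B by (auto simp: invertible_def)
  then have "(map_mat ?\<tau> B, ?\<tau>) \<in> carrier GammaL4"
    using inv by (auto simp: GammaL4_def map_mat_invertible field_auts_inv)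
  moreover have "(map_mat ?\<tau> B, ?\<tau>) \<otimes>\<^bsub>GammaL4\<^esub> x = \<one>\<^bsub>GammaL4\<^esub>"
    using B s by (simp add: GammaL4_def A map_mat_comp map_mat_id)
  ultimately show "\<exists>y\<in>carrier GammaL4. y \<otimes>\<^bsub>GammaL4\<^esub> x = \<one>\<^bsub>GammaL4\<^esub>" by blast
qed

definition Emat :: "'a::finite_field \<Rightarrow> 'a \<Rightarrow> 'a \<Rightarrow> 'a \<Rightarrow> 'a^4^4" where
  "Emat a b c t = vector [
     vector [1, 0, 0, 0],
     vector [- c, 1, 0, 0],
     vector [b - c * t, t, 1, 0],
     vector [a, b, c, 1]]"

lemma Emat_nth:
  "Emat a b c t $ 1 $ 1 = 1" "Emat a b c t $ 1 $ 2 = 0" "Emat a b c t $ 1 $ 3 = 0" "Emat a b c t $ 1 $ 4 = 0"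
  "Emat a b c t $ 2 $ 1 = - c" "Emat a b c t $ 2 $ 2 = 1" "Emat a b c t $ 2 $ 3 = 0" "Emat a b c t $ 2 $ 4 = 0"
  "Emat a b c t $ 3 $ 1 = b - c * t" "Emat a b c t $ 3 $ 2 = t" "Emat a b c t $ 3 $ 3 = 1" "Emat a b c t $ 3 $ 4 = 0"
  "Emat a b c t $ 4 $ 1 = a" "Emat a b c t $ 4 $ 2 = b" "Emat a b c t $ 4 $ 3 = c" "Emat a b c t $ 4 $ 4 = 1"
  unfolding Emat_def vector_def by simp_all

lemma Emat_mult:
  "Emat a b c t ** Emat a' b' c' t' =
   Emat (a + a' - b * c' + c * (b' - c' * t')) (b + b' + c * t') (c + c') (t + t')"
  by (simp add: vec_eq_iff forall_4 matrix_matrix_mult_def sum_4 Emat_nth algebra_simps)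

lemma Emat_invertible: "invertible (Emat a b c t)"
proof -
  have one: "Emat 0 0 0 0 = mat 1"
    by (simp add: vec_eq_iff forall_4 mat_def Emat_nth)
  let ?B = "Emat (- a) (c * t - b) (- c) (- t)"
  have "Emat a b c t ** ?B = mat 1" "?B ** Emat a b c t = mat 1"
    by (simp_all add: Emat_mult one[symmetric] algebra_simps)
  then show ?thesis unfolding invertible_def by blast
qed

definition gelt :: "('a::finite_field \<Rightarrow> 'a \<Rightarrow> 'a \<Rightarrow> 'a) \<Rightarrow> ('a \<Rightarrow> 'a \<Rightarrow> 'a \<Rightarrow> 'a \<Rightarrow> 'a) \<Rightarrow>
    'a \<Rightarrow> 'a \<Rightarrow> 'a \<Rightarrow> ('a^4^4) \<times> ('a \<Rightarrow> 'a)" where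
  "gelt T \<theta> a b c = (Emat a b c (T a b c), \<theta> a b c)"

definition Gset :: "('a::finite_field \<Rightarrow> 'a \<Rightarrow> 'a \<Rightarrow> 'a) \<Rightarrow> ('a \<Rightarrow> 'a \<Rightarrow> 'a \<Rightarrow> 'a \<Rightarrow> 'a) \<Rightarrow>
    (('a^4^4) \<times> ('a \<Rightarrow> 'a)) set" where
  "Gset T \<theta> = {gelt T \<theta> a b c | a b c. True}"

definition group_exp :: "('g, 'x) monoid_scheme \<Rightarrow> nat" where
  "group_exp G = (LEAST n. 0 < n \<and> (\<forall>x\<in>carrier G. x [^]\<^bsub>G\<^esub> n = \<one>\<^bsub>G\<^esub>))"

definition group_A :: "nat \<Rightarrow> nat \<Rightarrow> (nat \<Rightarrow> 'a::finite_field) \<Rightarrow> (('a^4^4) \<times> ('a \<Rightarrow> 'a)) monoid" where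
  "group_A p m s = GammaL4\<lparr>carrier := Gset (\<lambda>a b c. lin_poly p m s c) (\<lambda>a b c. id)\<rparr>"

definition params_B :: "nat \<Rightarrow> nat \<Rightarrow> (nat \<Rightarrow> 'a::finite_field) \<Rightarrow> 'a \<Rightarrow> bool" where
  "params_B p l s \<mu>\<^sub>C \<longleftrightarrow> prime p \<and> odd p \<and> CARD('a) = p ^ (p * l) \<and>
     (\<forall>i<p * l. s i \<in> subfld p l) \<and> \<mu>\<^sub>C \<in> subfld p l - {0}"

definition group_B :: "nat \<Rightarrow> nat \<Rightarrow> (nat \<Rightarrow> 'a::finite_field) \<Rightarrow> 'a \<Rightarrow>
    (('a^4^4) \<times> ('a \<Rightarrow> 'a)) monoid" where
  "group_B p l s \<mu>\<^sub>C = GammaL4\<lparr>carrier :=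
     Gset (\<lambda>a b c. lin_poly p (p * l) s c) (\<lambda>a b c. frob p l ^^ rep (tr p (p * l) (\<mu>\<^sub>C * c)))\<rparr>"

definition params_C :: "nat \<Rightarrow> nat \<Rightarrow> (nat \<Rightarrow> 'a::finite_field) \<Rightarrow> 'a \<Rightarrow> bool" where
  "params_C p l s \<mu>\<^sub>B \<longleftrightarrow> prime p \<and> odd p \<and> CARD('a) = p ^ (p * l) \<and>
     (\<forall>i<p * l. s i \<in> subfld p l) \<and> \<mu>\<^sub>B \<in> subfld p l - {0} \<and>
     (\<forall>i\<in>{1..<p * l}. \<mu>\<^sub>B * s i - s (p * l - i) ^ (p ^ i) * \<mu>\<^sub>B ^ (p ^ i) = 0)"

definition Qform :: "nat \<Rightarrow> nat \<Rightarrow> (nat \<Rightarrow> 'a::finite_field) \<Rightarrow> 'a \<Rightarrow> 'a \<Rightarrow> 'a" where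
  "Qform p m s \<mu>\<^sub>B x = - tr p m (\<mu>\<^sub>B * x * lin_poly p m s x)"

definition group_C :: "nat \<Rightarrow> nat \<Rightarrow> (nat \<Rightarrow> 'a::finite_field) \<Rightarrow> 'a \<Rightarrow>
    (('a^4^4) \<times> ('a \<Rightarrow> 'a)) monoid" where
  "group_C p l s \<mu>\<^sub>B = GammaL4\<lparr>carrier :=
     Gset (\<lambda>a b c. lin_poly p (p * l) s c)
       (\<lambda>a b c. frob p l ^^ rep (Qform p (p * l) s \<mu>\<^sub>B c / 2 + tr p (p * l) (\<mu>\<^sub>B * b)))\<rparr>"

definition params_D :: "nat \<Rightarrow> (nat \<Rightarrow> 'a::finite_field) \<Rightarrow> 'a \<Rightarrow> 'a \<Rightarrow> 'a \<Rightarrow> 'a \<Rightarrow> 'a \<Rightarrow> bool" where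
  "params_D l s u t\<^sub>C \<mu>\<^sub>B \<alpha> lam \<longleftrightarrow>
     (let \<mu>\<^sub>C = u - frob 3 l u; lam\<^sub>C = tr 3 (9 * l) (\<mu>\<^sub>C * t\<^sub>C) in
       CARD('a) = 3 ^ (9 * l) \<and> u \<in> subfld 3 (3 * l) \<and> \<mu>\<^sub>C \<in> subfld 3 l - {0} \<and> lam\<^sub>C \<noteq> 0 \<and>
       \<mu>\<^sub>B \<in> subfld 3 l - {0} \<and> (\<forall>i<9 * l. s i \<in> subfld 3 l) \<and>
       (\<forall>i\<in>{1..<9 * l}. - \<mu>\<^sub>B * s i + s (9 * l - i) ^ (3 ^ i) * \<mu>\<^sub>B ^ (3 ^ i) =
          \<mu>\<^sub>C * u ^ (3 ^ i) - u * \<mu>\<^sub>C ^ (3 ^ i)) \<and>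
       \<alpha> \<in> subfld 3 (3 * l) \<and> lam \<in> subfld 3 1 \<and> frob 3 l \<alpha> - \<alpha> = lam\<^sub>C * u + lam * \<mu>\<^sub>C)"

definition group_D :: "nat \<Rightarrow> (nat \<Rightarrow> 'a::finite_field) \<Rightarrow> 'a \<Rightarrow> 'a \<Rightarrow> 'a \<Rightarrow> 'a \<Rightarrow>
    (('a^4^4) \<times> ('a \<Rightarrow> 'a)) monoid" where
  "group_D l s u t\<^sub>C \<mu>\<^sub>B \<alpha> =
     (let \<mu>\<^sub>C = u - frob 3 l u; K = {z. tr 3 (9 * l) (\<mu>\<^sub>C * z) = 0}; S = lin_poly 3 (9 * l) s;
        g = frob 3 l; g\<^sub>1 = g ^^ 3 in
       GammaL4\<lparr>carrier := generate GammaL4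
         ({gelt (\<lambda>a b c. S c)
              (\<lambda>a b c. g\<^sub>1 ^^ rep (Qform 3 (9 * l) s \<mu>\<^sub>B c / 2 + tr 3 (9 * l) (\<alpha> * c + \<mu>\<^sub>B * b)))
              a b c | a b c. c \<in> K}
          \<union> {(Emat 0 0 t\<^sub>C (S t\<^sub>C), g)})\<rparr>)"

end

theory Submission
  imports Defs "HOL-Number_Theory.Residues" "HOL-Computational_Algebra.Polynomial"
begin

text \<open>
  Every element of the groups has the form \<open>x = (E(a, b, c, S(c)), \<sigma>)\<close> with \<open>S = S\<^sub>1\<close> additive and \<open>\<sigma>\<close> a
  power of the Frobenius map \<open>g\<close> of order \<open>n = p\<^sup>e\<close> that commutes with \<open>S\<close>, where \<open>e = 1\<close> in Constructions B
  and C and \<open>e = 2\<close> in Construction D.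
  If \<open>\<sigma>\<close> generates \<open>\<langle>g\<rangle>\<close>, then \<open>x\<^sup>n = (E(a', b', C, S(C)), 1)\<close>, where \<open>C\<close> is the trace of \<open>c\<close> to the
  fixed field of \<open>g\<close>; otherwise an earlier power of \<open>x\<close> already has trivial automorphism part.
  The \<open>k\<close>-th power of \<open>E(a, b, c, t)\<close> has bottom left entry \<open>k a - (k + 1 choose 3) c\<^sup>2 t\<close>, so its
  \<open>p\<close>-th power (\<open>p\<close> odd) is trivial unless \<open>p = 3\<close> and \<open>c\<^sup>2 t \<noteq> 0\<close>. Hence only the values of \<open>S\<close> on the
  fixed field matter. An element of maximal order is found because two nonzero
  additive maps have a common nonzero argument: the trace form that makes \<open>\<sigma>\<close> a generator, and
  \<open>c \<mapsto> S(C)\<close>.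
\<close>

section \<open>Additive maps in characteristic p and powers of Frobenius\<close>

lemma prime_CHAR_finite_field: "prime (CHAR('a::finite_field))"
  by (rule prime_CHAR_semidom) (simp add: finite_imp_CHAR_pos)

lemma CHAR_eq_of_CARD:
  assumes "prime p" "CARD('a::finite_field) = p ^ m"
  shows "CHAR('a) = p"
proof -
  have "CHAR('a) dvd p ^ m"
    using CHAR_dvd_CARD[where ?'a = 'a] assms(2) by simp
  then show ?thesis
    using assms(1) prime_CHAR_finite_field[where ?'a = 'a] by (meson prime_dvd_power primes_dvd_imp_eq)
qed

lemma CARD_finite_field_gt_1: "CARD('a::finite_field) > 1"
proof -
  have "card {0, 1 :: 'a} \<le> CARD('a)" by (intro card_mono) auto
  then show ?thesis by simp
qed

lemma power_add_char:
  assumes "CHAR('a::finite_field) = p"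
  shows "(x + y :: 'a) ^ (p ^ i) = x ^ (p ^ i) + y ^ (p ^ i)"
  using freshmans_dream' prime_CHAR_finite_field assms by blast

lemma power_sum_char:
  assumes "CHAR('a::finite_field) = p"
  shows "(\<Sum>j\<in>A. f j :: 'a) ^ (p ^ i) = (\<Sum>j\<in>A. f j ^ (p ^ i))"
  using freshmans_dream_sum' prime_CHAR_finite_field assms by blast

lemma tr_add:
  assumes "CHAR('a::finite_field) = p"
  shows "tr p m (x + y :: 'a) = tr p m x + tr p m y"
  by (simp add: tr_def power_add_char[OF assms] sum.distrib)

lemma lin_poly_add:
  assumes "CHAR('a::finite_field) = p"
  shows "lin_poly p m s (x + y :: 'a) = lin_poly p m s x + lin_poly p m s y"
  by (simp add: lin_poly_def power_add_char[OF assms] distrib_left sum.distrib)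

lemma additive_zero:
  fixes S :: "'a::ring \<Rightarrow> 'a"
  assumes "\<And>x y. S (x + y) = S x + S y"
  shows "S 0 = 0"
  using assms[of 0 0] by simp

lemma additive_uminus:
  fixes S :: "'a::ring \<Rightarrow> 'a"
  assumes "\<And>x y. S (x + y) = S x + S y"
  shows "S (- x) = - S x"
  using assms[of x "- x"] additive_zero[of S] assms by (simp add: eq_neg_iff_add_eq_0 add.commute)

lemma additive_sum:
  fixes S :: "'a::ring \<Rightarrow> 'a"
  assumes "\<And>x y. S (x + y) = S x + S y"
  shows "S (sum f A) = (\<Sum>i\<in>A. S (f i))"
  by (induction A rule: infinite_finite_induct) (simp_all add: assms additive_zero[of S])

text \<open>This is the recursion for the entry \<open>c\<close> of successive powers of a twisted
  element: each further multiplication applies \<open>\<sigma>\<close> and adds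
  \<open>c\<close>.\<close>

lemma sum_funpow_Suc:
  fixes \<sigma> :: "'a::ring \<Rightarrow> 'a"
  assumes "\<And>x y. \<sigma> (x + y) = \<sigma> x + \<sigma> y"
  shows "\<sigma> (\<Sum>i<n. (\<sigma> ^^ i) x) + x = (\<Sum>i<Suc n. (\<sigma> ^^ i) x)"
  by (subst sum.lessThan_Suc_shift) (simp add: additive_sum[of \<sigma>] assms add.commute)

lemma frob_funpow: "(frob p l ^^ k) x = x ^ (p ^ (l * k))"
  by (induction k) (simp_all add: frob_def power_mult[symmetric] power_add mult_ac)

lemma frob_funpow_period:
  assumes "CARD('a::finite_field) = p ^ (n * l)"
  shows "(frob p l ^^ n) = (id :: 'a \<Rightarrow> 'a)"
  using finite_field_power_card_eq_same[where ?'a = 'a] assms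
  by (auto simp: fun_eq_iff frob_funpow mult.commute)

lemma frob_funpow_field_auts:
  assumes "CHAR('a::finite_field) = p" 
  shows "(frob p l ^^ k) \<in> (field_auts :: ('a \<Rightarrow> 'a) set)"
proof -
  have p0: "p > 0"
    using prime_gt_0_nat[OF prime_CHAR_finite_field[where ?'a = 'a]] assms by simp
  let ?f = "frob p l ^^ k :: 'a \<Rightarrow> 'a"
  have add: "?f (x + y) = ?f x + ?f y" for x y
    by (simp add: frob_funpow power_add_char[OF assms])
  have "inj ?f"
  proof (rule injI)
    fix x y assume "?f x = ?f y"
    then have "?f (x - y) = 0" using add[of "x - y" y] by simp
    then show "x = y" by (simp add: frob_funpow)
  qed
  then have "bij ?f" by (simp add: finite_UNIV_inj_surj bij_def)
  then show ?thesis
    using add p0 by (simp add: field_auts_def frob_funpow power_mult_distrib)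
qed

lemma subfld_funpow:
  assumes "x \<in> subfld p l" shows "(frob p l ^^ k) x = x"
proof -
  have "frob p l x = x" using assms by (simp add: subfld_def frob_def)
  then show ?thesis by (induction k) auto
qed

text \<open>The coefficients are fixed by \<open>frob p l\<close>, and powers of Frobenius commute
  with each other.\<close>

lemma lin_poly_frob:
  assumes "CHAR('a::finite_field) = p" "\<forall>i<m. s i \<in> (subfld p l :: 'a set)"
  shows "(frob p l ^^ k) (lin_poly p m s x) = lin_poly p m s ((frob p l ^^ k) x)"
proof -
  have "(s i * x ^ (p ^ i)) ^ (p ^ (l * k)) = s i * (x ^ (p ^ (l * k))) ^ (p ^ i)" if "i < m" for i
    using subfld_funpow[of "s i" p l k] assms(2) that
    by (simp add: frob_funpow power_mult_distrib power_mult[symmetric] mult.commute)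
  then show ?thesis
    by (simp add: lin_poly_def frob_funpow power_sum_char[OF assms(1)])
qed

section \<open>Absolute and relative traces\<close>

lemma tr_frob:
  assumes "CHAR('a::finite_field) = p" "CARD('a) = p ^ m"
  shows "tr p m (x :: 'a) ^ p = tr p m x"
proof -
  have "tr p m x ^ p = (\<Sum>i<m. (x ^ (p ^ i)) ^ p)"
    using power_sum_char[OF assms(1), of "\<lambda>i. x ^ (p ^ i)" "{..<m}" 1] by (simp add: tr_def)
  also have "\<dots> = (\<Sum>i<m. x ^ (p ^ Suc i))"
    by (simp add: power_mult[symmetric] mult.commute)
  \<comment> \<open>The shifted sum lacks the term for \<open>i = 0\<close> and ends with
    \<open>x ^ (p ^ m) = x\<close>; the added \<open>x\<close> is cancelled at the end.\<close>
  also have "\<dots> + x = (\<Sum>i<Suc m. x ^ (p ^ i))"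
    by (subst sum.lessThan_Suc_shift) (simp add: add.commute)
  also have "\<dots> = tr p m x + x"
    using finite_field_power_card_eq_same[of x] assms(2) by (simp add: tr_def)
  finally show ?thesis by simp
qed

lemma tr_frob_funpow:
  assumes "CHAR('a::finite_field) = p" "CARD('a) = p ^ m"
  shows "tr p m ((frob p l ^^ k) (x :: 'a)) = tr p m x"
proof -
  have it: "tr p m x ^ (p ^ j) = tr p m x" for j
    by (induction j) (simp_all add: tr_frob[OF assms] power_mult)
  have "tr p m ((frob p l ^^ k) x) = tr p m x ^ (p ^ (l * k))"
    by (simp add: tr_def frob_funpow power_sum_char[OF assms(1)] power_mult[symmetric] mult.commute)
  with it show ?thesis by simp
qed

text \<open>\<open>X ^ p - X\<close> has at most \<open>p\<close> roots, and the images of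
  \<open>0, ..., p - 1\<close> are \<open>p\<close> distinct roots. So every fixed point of the
  \<open>p\<close>-th power map is some \<open>of_nat n\<close>, and the \<open>LEAST\<close> in
  \<open>rep\<close> is attained.\<close>

lemma of_nat_rep:
  assumes "CHAR('a::finite_field) = p" "(z :: 'a) ^ p = z"
  shows "of_nat (rep z) = z"
proof -
  have pr: "prime p"
    using prime_CHAR_finite_field[where ?'a = 'a] assms(1) by simp
  have p1: "p > 1" using pr prime_gt_1_nat by blast
  have inj: "inj_on (of_nat :: nat \<Rightarrow> 'a) {..<p}"
    using assms(1) by (auto simp: inj_on_def of_nat_eq_iff_cong_CHAR cong_def)
  have npow: "(of_nat n :: 'a) ^ p = of_nat n" for n
  proof (induction n)
    case 0 then show ?case using p1 by simp
  next
    case (Suc n)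
    then show ?case using power_add_char[OF assms(1), of 1 "of_nat n" 1] by simp
  qed
  let ?P = "Polynomial.monom 1 p - Polynomial.monom 1 1 :: 'a poly"
  have c: "poly.coeff ?P p = 1" using p1 by simp
  have P0: "?P \<noteq> 0" using c by (metis coeff_0 zero_neq_one)
  have roots: "{x. poly ?P x = 0} = {x. x ^ p = x}" by (simp add: poly_monom)
  have "Polynomial.degree ?P \<le> p"
    using p1 by (intro Polynomial.degree_diff_le) (auto simp: Polynomial.degree_monom_eq)
  then have "card {x :: 'a. x ^ p = x} \<le> p"
    using card_poly_roots_bound[OF P0] roots by simp
  moreover have "card (of_nat ` {..<p} :: 'a set) = p" using inj by (simp add: card_image)
  moreover have "of_nat ` {..<p} \<subseteq> {x :: 'a. x ^ p = x}" using npow by auto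
  ultimately have "of_nat ` {..<p} = {x :: 'a. x ^ p = x}"
    by (intro card_seteq) auto
  then have "z \<in> of_nat ` {..<p}" using assms(2) by simp
  then obtain n where "of_nat n = z" by auto
  then show ?thesis unfolding rep_def by (rule LeastI)
qed

text \<open>For \<open>CARD('a) = p ^ (n * l)\<close> this is the trace from \<open>'a\<close> to \<open>subfld p l\<close>.\<close>

definition rel_tr :: "nat \<Rightarrow> nat \<Rightarrow> nat \<Rightarrow> 'a::finite_field \<Rightarrow> 'a" where
  "rel_tr p l n x = (\<Sum>i<n. (frob p l ^^ i) x)"

text \<open>As a polynomial in \<open>x\<close> the trace has degree at most
  \<open>p ^ (l * (n - 1))\<close>, less than the size of the field, so it could vanish everywhere
  only as the zero polynomial. Its linear coefficient, coming from \<open>i = 0\<close> alone, is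
  1.\<close>

lemma rel_tr_nonzero:
  assumes "prime p" "CARD('a::finite_field) = p ^ (n * l)" 
  shows "\<exists>x :: 'a. rel_tr p l n x \<noteq> 0"
proof (rule ccontr)
  assume "\<not> ?thesis"
  then have z: "rel_tr p l n x = 0" for x :: 'a by simp
  have p1: "p > 1" using assms(1) prime_gt_1_nat by blast
  have pos: "n > 0" "l > 0" using CARD_finite_field_gt_1[where ?'a = 'a] assms(2)
    by (auto intro!: gr0I)
  let ?P = "\<Sum>i<n. Polynomial.monom 1 (p ^ (l * i)) :: 'a poly"
  have "poly ?P x = rel_tr p l n x" for x
    by (simp add: rel_tr_def poly_sum poly_monom frob_funpow)
  then have all: "{x. poly ?P x = 0} = UNIV" using z by auto
  have "poly.coeff ?P 1 = (\<Sum>i<n. if i = 0 then 1 else 0)"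
    unfolding coeff_sum
  proof (intro sum.cong refl)
    fix i
    have "p ^ (l * i) = 1 \<longleftrightarrow> i = 0" using p1 pos by simp
    then show "poly.coeff (Polynomial.monom 1 (p ^ (l * i))) 1 = (if i = 0 then 1 else 0 :: 'a)"
      by (simp only: coeff_monom)
  qed
  also have "\<dots> = 1" using pos by (simp add: sum.delta)
  finally have P0: "?P \<noteq> 0" by (metis coeff_0 zero_neq_one)
  have "Polynomial.degree ?P \<le> p ^ (l * (n - 1))"
    using p1 by (intro degree_sum_le)
      (auto simp: Polynomial.degree_monom_eq intro!: power_increasing mult_le_mono2)
  also have "\<dots> < p ^ (n * l)" using p1 pos by (intro power_strict_increasing) auto
  finally show False using card_poly_roots_bound[OF P0] all assms(2) by simp
qed

lemma rel_tr_add: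
  assumes "CHAR('a::finite_field) = p"
  shows "rel_tr p l n (x + y :: 'a) = rel_tr p l n x + rel_tr p l n y"
  by (simp add: rel_tr_def frob_funpow power_add_char[OF assms] sum.distrib)

lemma rel_tr_mult:
  assumes "\<mu> \<in> (subfld p l :: 'a::finite_field set)"
  shows "rel_tr p l n (\<mu> * x) = \<mu> * rel_tr p l n x"
proof -
  have "(frob p l ^^ i) (\<mu> * x) = \<mu> * (frob p l ^^ i) x" for i
    using subfld_funpow[OF assms, of i] by (simp add: frob_funpow power_mult_distrib)
  then show ?thesis by (simp add: rel_tr_def sum_distrib_left)
qed

lemma tr_eq_rel_tr: "tr p m x = rel_tr p 1 m x"
  by (simp add: tr_def rel_tr_def frob_funpow)

text \<open>Transitivity of the trace: each exponent below \<open>n * l\<close> is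
  \<open>i + j * l\<close> for exactly one pair with \<open>i < l\<close> and
  \<open>j < n\<close>.\<close>

lemma tr_rel_tr:
  assumes "CHAR('a::finite_field) = p"
  shows "tr p (n * l) (x :: 'a) = tr p l (rel_tr p l n x)"
proof -
  have "tr p l (rel_tr p l n x) = (\<Sum>i<l. \<Sum>j<n. x ^ (p ^ (i + j * l)))"
    by (simp add: tr_def rel_tr_def frob_funpow power_sum_char[OF assms] power_mult[symmetric]
        power_add[symmetric] mult.commute add.commute)
  also have "\<dots> = (\<Sum>j<n. \<Sum>i<l. x ^ (p ^ (i + j * l)))" by (rule sum.swap)
  also have "\<dots> = (\<Sum>j<n. \<Sum>i\<in>{j * l..<j * l + l}. x ^ (p ^ i))"
  proof (rule sum.cong[OF refl])
    fix j show "(\<Sum>i<l. x ^ (p ^ (i + j * l))) = (\<Sum>i\<in>{j * l..<j * l + l}. x ^ (p ^ i))"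
      by (rule sum.reindex_bij_witness[of _ "\<lambda>i. i - j * l" "\<lambda>i. i + j * l"]) auto
  qed
  also have "\<dots> = tr p (n * l) x"
    by (simp add: tr_def sum.nat_group)
  finally show ?thesis by simp
qed

text \<open>Over a full period \<open>\<sigma>\<close> only permutes the summands cyclically. This
  is what places relative traces in the fixed field.\<close>

lemma sum_funpow_fixed:
  fixes \<sigma> :: "'a::ring \<Rightarrow> 'a"
  assumes "\<And>x y. \<sigma> (x + y) = \<sigma> x + \<sigma> y" "\<sigma> ^^ n = id"
  shows "\<sigma> (\<Sum>i<n. (\<sigma> ^^ i) x) = (\<Sum>i<n. (\<sigma> ^^ i) x)"
  using sum_funpow_Suc[where \<sigma> = \<sigma> and n = n and x = x, OF assms(1)] assms(2) by simp

lemma rel_tr_in_subfld: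
  assumes "CHAR('a::finite_field) = p" "CARD('a) = p ^ (n * l)"
  shows "rel_tr p l n (x :: 'a) \<in> subfld p l"
  using sum_funpow_fixed[of "frob p l" n x] frob_funpow_period[OF assms(2)]
  by (simp add: rel_tr_def subfld_def frob_def power_add_char[OF assms(1)])

text \<open>The relative trace is linear over the subfield, so one nonzero value can be scaled to
  any \<open>y\<close>.\<close>

lemma rel_tr_onto:
  assumes "CHAR('a::finite_field) = p" "CARD('a) = p ^ (n * l)" "y \<in> (subfld p l :: 'a set)"
  shows "\<exists>x. rel_tr p l n x = y"
proof -
  have "prime p"
    using prime_CHAR_finite_field[where ?'a = 'a] assms(1) by simp
  then obtain x where x: "rel_tr p l n x \<noteq> (0 :: 'a)" using rel_tr_nonzero assms by blast
  have "y / rel_tr p l n x \<in> subfld p l"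
    using assms(3) rel_tr_in_subfld[OF assms(1,2), of x] by (simp add: subfld_def power_divide)
  from rel_tr_mult[OF this, of n x] x show ?thesis by auto
qed

text \<open>Multiplication by \<open>k\<close> permutes the residues modulo \<open>n\<close>, so the
  summands are merely reordered. Hence the trace stays the same when \<open>frob p l\<close> is
  replaced by such a power of it.\<close>

lemma sum_funpow_coprime:
  assumes "coprime k n" "f ^^ n = id"
  shows "(\<Sum>i<n. ((f ^^ k) ^^ i) x) = (\<Sum>i<n. (f ^^ i) x :: 'a::comm_monoid_add)"
proof -
  have inj: "inj_on (\<lambda>i. k * i mod n) {..<n}"
  proof (rule inj_onI)
    fix i j assume "i \<in> {..<n}" "j \<in> {..<n}" "k * i mod n = k * j mod n"
    then show "i = j"
      using cong_mult_lcancel_nat[OF assms(1), of i j] by (simp add: cong_def)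
  qed
  have bij: "bij_betw (\<lambda>i. k * i mod n) {..<n} {..<n}"
    unfolding bij_betw_def using inj by (intro conjI endo_inj_surj) auto
  have "((f ^^ k) ^^ i) x = (f ^^ (k * i mod n)) x" for i
    using funpow_mod_eq[where n = n and f = f and x = x and m = "k * i"] assms(2)
    by (simp add: funpow_mult mult.commute)
  then show ?thesis
    using sum.reindex_bij_betw[OF bij, of "\<lambda>i. (f ^^ i) x"] by simp
qed

section \<open>Powers of the elements E(a, b, c, t) in the semilinear group\<close>

lemma map_mat_Emat:
  assumes "\<sigma> \<in> field_auts"
  shows "map_mat \<sigma> (Emat a b c t) = Emat (\<sigma> a) (\<sigma> b) (\<sigma> c) (\<sigma> t)"
proof -
  have add: "\<sigma> (x + y) = \<sigma> x + \<sigma> y" and mult: "\<sigma> (x * y) = \<sigma> x * \<sigma> y" and one: "\<sigma> 1 = 1" for x y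
    using assms by (auto simp: field_auts_def)
  have minus: "\<sigma> (- x) = - \<sigma> x" for x using additive_uminus[of \<sigma>] add by blast
  have "\<sigma> (x - y) = \<sigma> x - \<sigma> y" for x y using add[of x "- y"] minus by simp
  then show ?thesis
    using field_auts_zero[OF assms] by (simp add: vec_eq_iff forall_4 map_mat_def Emat_nth mult one minus)
qed

lemma Emat_zero: "Emat 0 0 0 0 = mat 1"
  by (simp add: vec_eq_iff forall_4 mat_def Emat_nth)

lemma Emat_eq_one_iff: "Emat a b c t = mat 1 \<longleftrightarrow> a = 0 \<and> b = 0 \<and> c = 0 \<and> t = 0"
  unfolding Emat_zero[symmetric] by (auto simp: vec_eq_iff forall_4 Emat_nth)

lemma GammaL4_one: "\<one>\<^bsub>GammaL4\<^esub> = (mat 1, id)"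
  by (simp add: GammaL4_def)

lemma GammaL4_mult_Emat:
  assumes "\<tau> \<in> field_auts"
  shows "(Emat a b c t, \<sigma>) \<otimes>\<^bsub>GammaL4\<^esub> (Emat a' b' c' t', \<tau>) =
    (Emat (\<tau> a + a' - \<tau> b * c' + \<tau> c * (b' - c' * t')) (\<tau> b + b' + \<tau> c * t') (\<tau> c + c') (\<tau> t + t'), \<tau> \<circ> \<sigma>)"
  by (simp add: GammaL4_def map_mat_Emat[OF assms] Emat_mult)

lemma Emat_in_GammaL4: "\<sigma> \<in> field_auts \<Longrightarrow> (Emat a b c t, \<sigma>) \<in> carrier GammaL4"
  by (simp add: GammaL4_def Emat_invertible)

lemma id_field_auts: "id \<in> field_auts"
  by (simp add: field_auts_def)

text \<open>The entries \<open>c\<close> and \<open>t\<close> of a product depend only on those of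
  the factors and on the automorphism, so they can be followed alone. \<open>a'\<close> and
  \<open>b'\<close> stay existential because for odd \<open>p\<close> the \<open>p\<close>-th power
  of an untwisted element does not depend on them.\<close>

lemma Emat_twisted_pow:
  assumes \<sigma>: "\<sigma> \<in> field_auts" and S: "\<And>x y. S (x + y) = S x + S y" "\<And>x. \<sigma> (S x) = S (\<sigma> x)"
  shows "\<exists>a' b'. (Emat a b c (S c), \<sigma>) [^]\<^bsub>GammaL4\<^esub> (n::nat) =
    (Emat a' b' (\<Sum>i<n. (\<sigma> ^^ i) c) (S (\<Sum>i<n. (\<sigma> ^^ i) c)), \<sigma> ^^ n)"
proof (induction n)
  case 0
  then show ?case
    using additive_zero[of S] S by (auto simp: nat_pow_def GammaL4_one Emat_zero[symmetric])
next
  case (Suc n)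
  then obtain a' b' where IH: "(Emat a b c (S c), \<sigma>) [^]\<^bsub>GammaL4\<^esub> n =
    (Emat a' b' (\<Sum>i<n. (\<sigma> ^^ i) c) (S (\<Sum>i<n. (\<sigma> ^^ i) c)), \<sigma> ^^ n)" by blast
  have C: "\<sigma> (\<Sum>i<n. (\<sigma> ^^ i) c) + c = (\<Sum>i<Suc n. (\<sigma> ^^ i) c)"
    using \<sigma> by (intro sum_funpow_Suc) (simp add: field_auts_def)
  show ?case
    unfolding C[symmetric] by (auto simp: nat_pow_def[symmetric] IH GammaL4_mult_Emat[OF \<sigma>] S)
qed

text \<open>From \<open>n\<close> to \<open>n + 1\<close> the contributions of \<open>b\<close> to
  the bottom left entry cancel, and \<open>(n + 1 choose 2)\<close> times
  \<open>c\<^sup>2 * t\<close> is subtracted; these multiples add up to the binomial coefficient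
  with 3.\<close>

lemma Emat_id_pow:
  "(Emat a b c t, id) [^]\<^bsub>GammaL4\<^esub> (n::nat) =
    (Emat (of_nat n * a - of_nat (Suc n choose 3) * (c\<^sup>2 * t)) (of_nat n * b + of_nat (n choose 2) * (c * t))
      (of_nat n * c) (of_nat n * t), id)"
proof (induction n)
  case 0
  show ?case by (simp add: nat_pow_def GammaL4_one Emat_zero[symmetric] numeral_3_eq_3 numeral_2_eq_2 id_def)
next
  case (Suc n)
  have 1: "Suc (Suc n) choose 3 = n + (n choose 2) + (Suc n choose 3)"
    by (simp add: numeral_3_eq_3 numeral_2_eq_2)
  have 2: "Suc n choose 2 = n + (n choose 2)" by (simp add: numeral_2_eq_2)
  show ?case
    unfolding nat_pow_Suc Suc.IH GammaL4_mult_Emat[OF id_field_auts] 1 2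
    by (simp add: algebra_simps power2_eq_square id_def comp_def)
qed

text \<open>\<open>p\<close> divides \<open>(p choose 2)\<close> and, if \<open>p > 3\<close>, also
  \<open>(p choose 3)\<close>, while \<open>(3 choose 3) = 1\<close>. This is where
  \<open>p = 3\<close> becomes exceptional.\<close>

lemma of_nat_choose_odd_prime:
  assumes "CHAR('a::finite_field) = p" "prime p" "odd p"
  shows "of_nat (p choose 2) = (0 :: 'a)" "of_nat (Suc p choose 3) = (if p = 3 then 1 else 0 :: 'a)"
proof -
  have p: "p \<ge> 3" using assms(2,3) prime_ge_2_nat[of p] by (cases "p = 2") auto
  show 2: "of_nat (p choose 2) = (0 :: 'a)"
    using p assms(1) dvd_choose_prime[of 2 p] assms(2) by (simp add: of_nat_eq_0_iff_char_dvd)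
  have S: "Suc p choose 3 = (p choose 2) + (p choose 3)"
    by (simp add: numeral_3_eq_3 numeral_2_eq_2)
  have "of_nat (p choose 3) = (0 :: 'a)" if "p \<noteq> 3"
    using that p assms(1) dvd_choose_prime[of 3 p] assms(2) by (simp add: of_nat_eq_0_iff_char_dvd)
  then show "of_nat (Suc p choose 3) = (if p = 3 then 1 else 0 :: 'a)"
    unfolding S by (auto simp: 2)
qed

lemma Emat_pow_char:
  assumes "CHAR('a::finite_field) = p" "prime p" "odd p"
  shows "(Emat a b c (t :: 'a), id) [^]\<^bsub>GammaL4\<^esub> p = (Emat (if p = 3 then - (c\<^sup>2 * t) else 0) 0 0 0, id)"
proof -
  have "of_nat p = (0 :: 'a)" using assms(1) of_nat_CHAR by blast
  then show ?thesis by (simp add: Emat_id_pow of_nat_choose_odd_prime[OF assms] del: binomial_Suc_Suc)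
qed

text \<open>For odd \<open>p\<close> the \<open>p\<close>-th power has at most its bottom left entry
  off the diagonal, so its own \<open>p\<close>-th power is trivial. For \<open>p = 2\<close> the
  coefficients of the fourth power are checked directly.\<close>

lemma Emat_pow_char_sq:
  assumes "CHAR('a::finite_field) = p" "prime p"
  shows "(Emat a b c (t :: 'a), id) [^]\<^bsub>GammaL4\<^esub> (p ^ 2) = \<one>\<^bsub>GammaL4\<^esub>"
proof -
  interpret GL: group "GammaL4 :: (('a^4^4) \<times> ('a \<Rightarrow> 'a)) monoid" by (rule group_GammaL4)
  show ?thesis
  proof (cases "p = 2")
    case True
    then have "(2 :: 'a) = 0" using assms(1) of_nat_CHAR[where ?'a = 'a] by simp
    then have two: "of_nat (2 * k) = (0 :: 'a)" for k by simp
    \<comment> \<open>The three coefficients are 4, 10 and 6, the doubles of 2, 5 and 3.\<close>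
    have "of_nat (4::nat) = (0 :: 'a)" "of_nat (Suc 4 choose 3) = (0 :: 'a)" "of_nat (4 choose 2) = (0 :: 'a)"
      using two[of 2] two[of 5] two[of 3] by (simp_all add: numeral_eq_Suc)
    then show ?thesis unfolding GammaL4_one Emat_zero[symmetric] using True by (simp add: Emat_id_pow del: binomial_Suc_Suc)
  next
    case False
    then have "odd p" using assms(2) prime_odd_nat prime_ge_2_nat[of p] by force
    have "(Emat a b c t, id) [^]\<^bsub>GammaL4\<^esub> (p ^ 2) = ((Emat a b c t, id) [^]\<^bsub>GammaL4\<^esub> p) [^]\<^bsub>GammaL4\<^esub> p"
      using GL.nat_pow_pow[OF Emat_in_GammaL4[OF id_field_auts]] by (simp add: power2_eq_square)
    then show ?thesis
      by (simp add: Emat_pow_char[OF assms \<open>odd p\<close>] GammaL4_one Emat_zero)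
  qed
qed

section \<open>Exponents of sets of twisted elements\<close>

text \<open>The order of \<open>x\<close> divides \<open>p ^ Suc k\<close> but not
  \<open>p ^ k\<close>, so it equals \<open>p ^ Suc k\<close> and divides every valid exponent.
  \<open>X\<close> is any subset, since powers and unit are those of \<open>G\<close>; the sets
  \<open>Gset\<close> therefore fit in directly.\<close>

lemma group_exp_eq_prime_power:
  assumes G: "group G" and p: "prime p" and X: "X \<subseteq> carrier G"
    and all: "\<And>x. x \<in> X \<Longrightarrow> x [^]\<^bsub>G\<^esub> ((p::nat) ^ Suc k) = \<one>\<^bsub>G\<^esub>"
    and x: "x \<in> X" "x [^]\<^bsub>G\<^esub> (p ^ k) \<noteq> \<one>\<^bsub>G\<^esub>"
  shows "group_exp (G\<lparr>carrier := X\<rparr>) = p ^ Suc k"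
proof -
  interpret group G by (rule G)
  have xc: "x \<in> carrier G" using x X by auto
  have pw: "y [^]\<^bsub>G\<lparr>carrier := X\<rparr>\<^esub> n = y [^]\<^bsub>G\<^esub> n" for y and n :: nat
    by (simp add: nat_pow_def)
  show ?thesis
    unfolding group_exp_def
  proof (rule Least_equality)
    show "0 < p ^ Suc k \<and> (\<forall>x\<in>carrier (G\<lparr>carrier := X\<rparr>). x [^]\<^bsub>G\<lparr>carrier := X\<rparr>\<^esub> p ^ Suc k = \<one>\<^bsub>G\<lparr>carrier := X\<rparr>\<^esub>)"
      using all p prime_gt_0_nat by (auto simp: pw simp del: power_Suc)
  next
    fix n :: nat assume n: "0 < n \<and> (\<forall>x\<in>carrier (G\<lparr>carrier := X\<rparr>). x [^]\<^bsub>G\<lparr>carrier := X\<rparr>\<^esub> n = \<one>\<^bsub>G\<lparr>carrier := X\<rparr>\<^esub>)"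
    then have "ord x dvd n" using x xc by (auto simp: pw pow_eq_id)
    have "ord x dvd p ^ Suc k" using all[OF x(1)] xc pow_eq_id by blast
    then obtain j where j: "j \<le> Suc k" "ord x = p ^ j" using p divides_primepow_nat by blast
    have "\<not> ord x dvd p ^ k" using x(2) xc pow_eq_id by blast
    then have "j = Suc k" using j le_imp_power_dvd[of j k p] by (metis le_SucE)
    then show "p ^ Suc k \<le> n" using \<open>ord x dvd n\<close> j n by (simp add: dvd_imp_le)
  qed
qed

text \<open>A common frame for Constructions B, C and D. The exponent \<open>k\<close> is
  independent of \<open>a\<close>, \<open>b\<close>, \<open>c\<close>, so closure under products
  rests only on \<open>S\<close> being additive and commuting with \<open>frob p l\<close>.\<close>

definition twisted :: "nat \<Rightarrow> nat \<Rightarrow> ('a::finite_field \<Rightarrow> 'a) \<Rightarrow> (('a^4^4) \<times> ('a \<Rightarrow> 'a)) set" where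
  "twisted p l S = {(Emat a b c (S c), frob p l ^^ k) | a b c k. True}"

lemma twisted_subset:
  assumes "CHAR('a::finite_field) = p"
  shows "twisted p l (S :: 'a \<Rightarrow> 'a) \<subseteq> carrier GammaL4"
  using frob_funpow_field_auts[OF assms] by (auto simp: twisted_def Emat_in_GammaL4)

lemma twisted_mult:
  assumes "CHAR('a::finite_field) = p" "\<forall>i<m. s i \<in> (subfld p l :: 'a set)"
    and "x \<in> twisted p l (lin_poly p m s)" "y \<in> twisted p l (lin_poly p m s)"
  shows "x \<otimes>\<^bsub>GammaL4\<^esub> y \<in> twisted p l (lin_poly p m s)"
proof -
  obtain a b c k where x: "x = (Emat a b c (lin_poly p m s c), frob p l ^^ k)"
    using assms(3) by (auto simp: twisted_def)
  obtain a' b' c' k' where y: "y = (Emat a' b' c' (lin_poly p m s c'), frob p l ^^ k')"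
    using assms(4) by (auto simp: twisted_def)
  show ?thesis
    unfolding x y GammaL4_mult_Emat[OF frob_funpow_field_auts[OF assms(1)]] lin_poly_frob[OF assms(1,2)]
      lin_poly_add[OF assms(1), symmetric] funpow_add[symmetric]
    by (auto simp: twisted_def)
qed

lemma twisted_pow:
  assumes "CHAR('a::finite_field) = p" "\<forall>i<m. s i \<in> (subfld p l :: 'a set)"
  shows "\<exists>a' b'. (Emat a b c (lin_poly p m s c), frob p l ^^ k) [^]\<^bsub>GammaL4\<^esub> (n::nat) =
    (Emat a' b' (\<Sum>i<n. ((frob p l ^^ k) ^^ i) c) (lin_poly p m s (\<Sum>i<n. ((frob p l ^^ k) ^^ i) c)),
     (frob p l ^^ k) ^^ n)"
  by (rule Emat_twisted_pow)
    (simp_all add: frob_funpow_field_auts[OF assms(1)] lin_poly_frob[OF assms] lin_poly_add[OF assms(1)])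

lemma twisted_pow_coprime:
  assumes "CHAR('a::finite_field) = p" "\<forall>i<m. s i \<in> (subfld p l :: 'a set)"
    and "CARD('a) = p ^ (n * l)" "coprime k n"
  shows "\<exists>a' b'. (Emat a b c (lin_poly p m s c), frob p l ^^ k) [^]\<^bsub>GammaL4\<^esub> n =
    (Emat a' b' (rel_tr p l n c) (lin_poly p m s (rel_tr p l n c)), id)"
proof -
  have fn: "frob p l ^^ n = (id :: 'a \<Rightarrow> 'a)" by (rule frob_funpow_period[OF assms(3)])
  have "(frob p l ^^ k) ^^ n = (frob p l ^^ n) ^^ k" by (simp add: funpow_mult mult.commute)
  also have "\<dots> = (id :: 'a \<Rightarrow> 'a)" unfolding fn by (rule id_funpow)
  finally show ?thesis
    using twisted_pow[OF assms(1,2), of a b c k n] sum_funpow_coprime[OF assms(4) fn, of c]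
    by (simp add: rel_tr_def)
qed

text \<open>If \<open>p\<close> divides \<open>k\<close>, the power \<open>p ^ (e - 1)\<close>
  removes the automorphism and a further \<open>p ^ 2\<close> gives the unit. Otherwise
  \<open>p ^ e\<close> removes it and leaves entries \<open>C\<close> and \<open>S(C)\<close> with
  \<open>C\<close> in the fixed field; then \<open>p ^ 2\<close> always suffices, and
  \<open>p\<close> suffices if \<open>p\<close> is not 3 or \<open>S(C) = 0\<close>.\<close>

lemma twisted_pow_eq_one:
  assumes "CHAR('a::finite_field) = p" "prime p" "odd p" "\<forall>i<m. s i \<in> (subfld p l :: 'a set)"
    and "CARD('a) = p ^ (p ^ e * l)" "e > 0" "x \<in> twisted p l (lin_poly p m s)"
  shows "x [^]\<^bsub>GammaL4\<^esub> (p ^ (e + 2)) = \<one>\<^bsub>GammaL4\<^esub>"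
    and "p \<noteq> 3 \<or> (\<forall>y\<in>subfld p l. lin_poly p m s y = 0) \<Longrightarrow>
      x [^]\<^bsub>GammaL4\<^esub> (p ^ (e + 1)) = \<one>\<^bsub>GammaL4\<^esub>"
proof -
  interpret GL: group "GammaL4 :: (('a^4^4) \<times> ('a \<Rightarrow> 'a)) monoid" by (rule group_GammaL4)
  let ?S = "lin_poly p m s"
  obtain a b c k where x: "x = (Emat a b c (?S c), frob p l ^^ k)"
    using assms(7) by (auto simp: twisted_def)
  have xc: "x \<in> carrier GammaL4" using twisted_subset[OF assms(1)] assms(7) by blast
  have split: "x [^]\<^bsub>GammaL4\<^esub> (p ^ (i + j)) = (x [^]\<^bsub>GammaL4\<^esub> (p ^ i)) [^]\<^bsub>GammaL4\<^esub> (p ^ j)" for i j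
    using GL.nat_pow_pow[OF xc] by (simp add: power_add)
  have "x [^]\<^bsub>GammaL4\<^esub> (p ^ (e + 2)) = \<one>\<^bsub>GammaL4\<^esub> \<and>
    (p \<noteq> 3 \<or> (\<forall>y\<in>subfld p l. ?S y = 0) \<longrightarrow> x [^]\<^bsub>GammaL4\<^esub> (p ^ (e + 1)) = \<one>\<^bsub>GammaL4\<^esub>)"
  proof (cases "p dvd k")
    case True
    then obtain k' where k': "k = p * k'" by auto
    have "k * p ^ (e - 1) = p ^ e * k'" using \<open>e > 0\<close> by (cases e) (simp_all add: k')
    then have "(frob p l ^^ k) ^^ (p ^ (e - 1)) = (frob p l ^^ (p ^ e)) ^^ k'"
      by (simp add: funpow_mult)
    also have "\<dots> = (id :: 'a \<Rightarrow> 'a)" unfolding frob_funpow_period[OF assms(5)] by (rule id_funpow)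
    finally obtain a' b' c' t' where "x [^]\<^bsub>GammaL4\<^esub> (p ^ (e - 1)) = (Emat a' b' c' t', id)"
      using twisted_pow[OF assms(1,4), of a b c k "p ^ (e - 1)"] x by auto
    then have one: "x [^]\<^bsub>GammaL4\<^esub> (p ^ (e + 1)) = \<one>\<^bsub>GammaL4\<^esub>"
      using split[of "e - 1" 2] Emat_pow_char_sq[OF assms(1,2)] \<open>e > 0\<close> by simp
    then have "x [^]\<^bsub>GammaL4\<^esub> (p ^ (e + 2)) = \<one>\<^bsub>GammaL4\<^esub>"
      using split[of "e + 1" 1] by simp
    with one show ?thesis by simp
  next
    case False
    then have "coprime k (p ^ e)"
      using assms(2) by (metis prime_imp_coprime coprime_commute coprime_power_right_iff)
    from twisted_pow_coprime[OF assms(1,4,5) this, of a b c] obtain a' b' where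
      n: "x [^]\<^bsub>GammaL4\<^esub> (p ^ e) = (Emat a' b' (rel_tr p l (p ^ e) c) (?S (rel_tr p l (p ^ e) c)), id)"
      using x by auto
    have "x [^]\<^bsub>GammaL4\<^esub> (p ^ (e + 1)) = \<one>\<^bsub>GammaL4\<^esub>" if "p \<noteq> 3 \<or> (\<forall>y\<in>subfld p l. ?S y = 0)"
      using split[of e 1] Emat_pow_char[OF assms(1-3)] that rel_tr_in_subfld[OF assms(1,5), of c] n
      by (auto simp: GammaL4_one Emat_zero)
    then show ?thesis
      using split[of e 2] n Emat_pow_char_sq[OF assms(1,2)] by simp
  qed
  then show "x [^]\<^bsub>GammaL4\<^esub> (p ^ (e + 2)) = \<one>\<^bsub>GammaL4\<^esub>"
    and "p \<noteq> 3 \<or> (\<forall>y\<in>subfld p l. ?S y = 0) \<Longrightarrow> x [^]\<^bsub>GammaL4\<^esub> (p ^ (e + 1)) = \<one>\<^bsub>GammaL4\<^esub>"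
    by auto
qed

text \<open>The upper bounds hold on all of \<open>twisted\<close>; \<open>ex1\<close> and
  \<open>ex2\<close> supply elements attaining them. The power \<open>p ^ e\<close> of the first has
  the nonzero entry \<open>C\<close>. For \<open>p = 3\<close> the power \<open>3 ^ (e + 1)\<close>
  of the second has the nonzero bottom left entry \<open>- C\<^sup>2 * S(C)\<close>.\<close>

lemma group_exp_twisted:
  assumes "prime p" "odd p" "CARD('a::finite_field) = p ^ (p ^ e * l)" "e > 0"
    and s: "\<forall>i<m. s i \<in> (subfld p l :: 'a set)"
    and X: "X \<subseteq> twisted p l (lin_poly p m s)"
    and ex1: "\<exists>a b c k. (Emat a b c (lin_poly p m s c), frob p l ^^ k) \<in> X \<and> \<not> p dvd k \<and>
      rel_tr p l (p ^ e) c \<noteq> 0"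
    and ex2: "\<exists>y\<in>subfld p l. lin_poly p m s y \<noteq> 0 \<Longrightarrow>
      \<exists>a b c k. (Emat a b c (lin_poly p m s c), frob p l ^^ k) \<in> X \<and> \<not> p dvd k \<and>
      lin_poly p m s (rel_tr p l (p ^ e) c) \<noteq> 0"
  shows "group_exp (GammaL4\<lparr>carrier := X\<rparr>) \<in> {p ^ (e + 1), p ^ (e + 2)} \<and>
    (group_exp (GammaL4\<lparr>carrier := X\<rparr>) = p ^ (e + 2) \<longleftrightarrow>
      p = 3 \<and> (\<exists>y\<in>subfld 3 l. lin_poly p m s y \<noteq> 0))"
proof -
  interpret GL: group "GammaL4 :: (('a^4^4) \<times> ('a \<Rightarrow> 'a)) monoid" by (rule group_GammaL4)
  let ?S = "lin_poly p m s"
  have ch: "CHAR('a) = p" using CHAR_eq_of_CARD assms(1,3) by blast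
  have Xc: "X \<subseteq> carrier GammaL4" using X twisted_subset[OF ch] by blast
  have ne: "p ^ (e + 1) \<noteq> p ^ (e + 2)" using prime_gt_1_nat[OF assms(1)] by simp
  have pw: "\<exists>a' b'. (Emat a b c (?S c), frob p l ^^ k) [^]\<^bsub>GammaL4\<^esub> (p ^ e) =
    (Emat a' b' (rel_tr p l (p ^ e) c) (?S (rel_tr p l (p ^ e) c)), id)" if "\<not> p dvd k" for a b c k
    by (rule twisted_pow_coprime[OF ch s assms(3)])
      (use that assms(1) in \<open>metis prime_imp_coprime coprime_commute coprime_power_right_iff\<close>)
  show ?thesis
  proof (cases "p = 3 \<and> (\<exists>y\<in>subfld 3 l. ?S y \<noteq> 0)")
    case True
    then obtain a b c k where x: "(Emat a b c (?S c), frob p l ^^ k) \<in> X" "\<not> p dvd k"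
      and ne0: "?S (rel_tr p l (p ^ e) c) \<noteq> 0" using ex2 by blast
    let ?x = "(Emat a b c (?S c), frob p l ^^ k)"
    have xc: "?x \<in> carrier GammaL4" using x Xc by blast
    obtain a' b' where x': "?x [^]\<^bsub>GammaL4\<^esub> (p ^ e) =
      (Emat a' b' (rel_tr p l (p ^ e) c) (?S (rel_tr p l (p ^ e) c)), id)"
      using pw[OF x(2)] by blast
    have "rel_tr p l (p ^ e) c \<noteq> 0" using ne0 additive_zero[of ?S] lin_poly_add[OF ch] by metis
    moreover have x'': "?x [^]\<^bsub>GammaL4\<^esub> (p ^ (e + 1)) = (?x [^]\<^bsub>GammaL4\<^esub> (p ^ e)) [^]\<^bsub>GammaL4\<^esub> p"
      using GL.nat_pow_pow[OF xc] by (simp add: mult.commute)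
    ultimately have "?x [^]\<^bsub>GammaL4\<^esub> (p ^ (e + 1)) \<noteq> \<one>\<^bsub>GammaL4\<^esub>"
      unfolding x'' x' Emat_pow_char[OF ch assms(1,2)] GammaL4_one using True ne0
      by (simp add: Emat_eq_one_iff)
    then have "group_exp (GammaL4\<lparr>carrier := X\<rparr>) = p ^ Suc (e + 1)"
      using twisted_pow_eq_one(1)[OF ch assms(1,2) s assms(3,4)] X
      by (intro group_exp_eq_prime_power[OF group_GammaL4 assms(1) Xc _ x(1)]) auto
    with True show ?thesis by auto
  next
    case False
    obtain a b c k where x: "(Emat a b c (?S c), frob p l ^^ k) \<in> X" "\<not> p dvd k"
      and ne0: "rel_tr p l (p ^ e) c \<noteq> 0" using ex1 by blast
    let ?x = "(Emat a b c (?S c), frob p l ^^ k)"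
    obtain a' b' where "?x [^]\<^bsub>GammaL4\<^esub> (p ^ e) =
      (Emat a' b' (rel_tr p l (p ^ e) c) (?S (rel_tr p l (p ^ e) c)), id)"
      using pw[OF x(2)] by blast
    then have "?x [^]\<^bsub>GammaL4\<^esub> (p ^ e) \<noteq> \<one>\<^bsub>GammaL4\<^esub>"
      using ne0 by (simp add: GammaL4_one Emat_eq_one_iff)
    moreover have "x [^]\<^bsub>GammaL4\<^esub> (p ^ Suc e) = \<one>\<^bsub>GammaL4\<^esub>" if "x \<in> X" for x
      using twisted_pow_eq_one(2)[OF ch assms(1,2) s assms(3,4), of x] X that False by auto
    ultimately have "group_exp (GammaL4\<lparr>carrier := X\<rparr>) = p ^ Suc e"
      by (intro group_exp_eq_prime_power[OF group_GammaL4 assms(1) Xc _ x(1)])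
    with False ne show ?thesis by simp
  qed
qed

section \<open>Arguments that yield elements of maximal order\<close>

text \<open>Two proper subgroups, here the kernels, never cover a group: if neither \<open>x\<close>
  nor \<open>y\<close> works, then \<open>f (x + y) = f x\<close> and
  \<open>h (x + y) = h y\<close>.\<close>

lemma additive_both_nonzero:
  fixes f h :: "'a::ring \<Rightarrow> 'a"
  assumes "\<And>x y. f (x + y) = f x + f y" "\<And>x y. h (x + y) = h x + h y" "f x \<noteq> 0" "h y \<noteq> 0"
  shows "\<exists>z. f z \<noteq> 0 \<and> h z \<noteq> 0"
proof (rule ccontr)
  assume *: "\<not> ?thesis"
  then have "h x = 0" "f y = 0" using assms(3,4) by auto
  then have "f (x + y) \<noteq> 0" "h (x + y) \<noteq> 0" using assms by auto
  with * show False by blast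
qed

lemma rep_not_dvd:
  assumes "CHAR('a::finite_field) = p" "(z :: 'a) ^ p = z" "z \<noteq> 0"
  shows "\<not> p dvd rep z"
  using of_nat_rep[OF assms(1,2)] assms(1,3) of_nat_eq_0_iff_char_dvd by metis

lemma tr_mult_nonzero:
  assumes "prime p" "CARD('a::finite_field) = p ^ m" "\<mu> \<noteq> (0::'a)"
  shows "\<exists>x. tr p m (\<mu> * x) \<noteq> 0"
proof -
  obtain x :: 'a where "tr p m x \<noteq> 0"
    using rel_tr_nonzero[of p m 1] assms(1,2) by (auto simp: tr_eq_rel_tr)
  then have "tr p m (\<mu> * (x / \<mu>)) \<noteq> 0" using assms(3) by simp
  then show ?thesis by blast
qed

text \<open>Since \<open>\<mu>\<close> lies in the subfield, the trace form given by
  \<open>\<mu>\<close> factors through the relative trace.\<close>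

lemma rel_tr_nonzero_of_tr:
  assumes "CHAR('a::finite_field) = p" "\<mu> \<in> (subfld p l :: 'a set)" "tr p (n * l) (\<mu> * x) \<noteq> 0"
  shows "rel_tr p l n x \<noteq> 0"
proof
  assume "rel_tr p l n x = 0"
  then have "tr p (n * l) (\<mu> * x) = tr p l 0"
    unfolding tr_rel_tr[OF assms(1)] rel_tr_mult[OF assms(2)] by simp
  also have "\<dots> = 0" using additive_zero[of "tr p l"] tr_add[OF assms(1)] by blast
  finally show False using assms(3) by simp
qed

text \<open>In Construction B the first condition makes the automorphism a generator; in
  Construction D it puts \<open>c\<close> outside \<open>K\<close>. The second keeps
  \<open>S(C)\<close> nonzero.\<close>

lemma tr_and_lin_poly_rel_tr_nonzero:
  assumes "prime p" "CARD('a::finite_field) = p ^ (n * l)" "\<mu> \<noteq> 0"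
    and "y \<in> (subfld p l :: 'a set)" "lin_poly p m s y \<noteq> 0"
  shows "\<exists>c. tr p (n * l) (\<mu> * c) \<noteq> 0 \<and> lin_poly p m s (rel_tr p l n c) \<noteq> 0"
proof -
  have ch: "CHAR('a) = p" using CHAR_eq_of_CARD assms(1,2) by blast
  obtain x where "tr p (n * l) (\<mu> * x) \<noteq> 0" using tr_mult_nonzero[OF assms(1-3)] by blast
  moreover obtain z where "rel_tr p l n z = y" using rel_tr_onto[OF ch assms(2,4)] by blast
  ultimately show ?thesis
    using assms(5)
    by (intro additive_both_nonzero[of "\<lambda>c. tr p (n * l) (\<mu> * c)" "\<lambda>c. lin_poly p m s (rel_tr p l n c)" x z])
      (simp_all add: tr_add[OF ch] lin_poly_add[OF ch] rel_tr_add[OF ch] distrib_left)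
qed

section \<open>Construction A\<close>

text \<open>The equivalence is restricted to odd \<open>p\<close>: for \<open>p = 2\<close> the
  square of \<open>E(a, b, c, S(c))\<close> has bottom row entries \<open>- c\<^sup>2 * S(c)\<close>
  and \<open>c * S(c)\<close>, so exponent 4 occurs whenever \<open>S\<close> is not zero.\<close>

lemma group_exp_A:
  fixes s :: "nat \<Rightarrow> 'a::finite_field"
  assumes "prime p" "CARD('a) = p ^ m"
  shows "group_exp (group_A p m s) \<in> {p, p ^ 2} \<and>
    (odd p \<longrightarrow> (group_exp (group_A p m s) = p ^ 2 \<longleftrightarrow> p = 3 \<and> (\<exists>x. lin_poly p m s x \<noteq> 0)))"
proof -
  let ?S = "lin_poly p m s"
  let ?X = "Gset (\<lambda>a b c. ?S c) (\<lambda>a b c. id)"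
  have ch: "CHAR('a) = p" using CHAR_eq_of_CARD assms by blast
  have X: "?X = {(Emat a b c (?S c), id) | a b c. True}" by (simp add: Gset_def gelt_def)
  have Xc: "?X \<subseteq> carrier GammaL4" by (auto simp: X Emat_in_GammaL4 id_field_auts)
  have ne: "p \<noteq> p ^ 2" using prime_gt_1_nat[OF assms(1)] by (simp add: power2_eq_square)
  have S0: "?S 0 = 0" using additive_zero[of ?S] lin_poly_add[OF ch] by blast
  have sq: "x [^]\<^bsub>GammaL4\<^esub> (p ^ Suc 1) = \<one>\<^bsub>GammaL4\<^esub>" if "x \<in> ?X" for x
    using that Emat_pow_char_sq[OF ch assms(1)] by (auto simp: X numeral_2_eq_2)
  have big: "group_exp (group_A p m s) = p ^ 2" if "x \<in> ?X" "x [^]\<^bsub>GammaL4\<^esub> p \<noteq> \<one>\<^bsub>GammaL4\<^esub>" for x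
    using group_exp_eq_prime_power[OF group_GammaL4 assms(1) Xc sq that(1)] that(2)
    by (simp add: group_A_def numeral_2_eq_2)
  have small: "group_exp (group_A p m s) = p" if *: "\<And>x. x \<in> ?X \<Longrightarrow> x [^]\<^bsub>GammaL4\<^esub> p = \<one>\<^bsub>GammaL4\<^esub>"
  proof -
    \<comment> \<open>\<open>E(1, 0, 0, 0)\<close> is not the unit, which excludes exponent
      1.\<close>
    have "(Emat 1 0 0 (?S 0), id) \<in> ?X" unfolding X by blast
    moreover have "(Emat 1 0 0 (?S 0), id) [^]\<^bsub>GammaL4\<^esub> (p ^ 0) \<noteq> \<one>\<^bsub>GammaL4\<^esub>"
      using Emat_id_pow[of 1 0 0 "?S 0" 1] by (simp add: S0 GammaL4_one Emat_eq_one_iff)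
    ultimately show ?thesis
      using group_exp_eq_prime_power[OF group_GammaL4 assms(1) Xc, of 0] * by (simp add: group_A_def)
  qed
  have "group_exp (group_A p m s) \<in> {p, p ^ 2}" using big small by blast
  moreover have "group_exp (group_A p m s) = p ^ 2 \<longleftrightarrow> p = 3 \<and> (\<exists>x. ?S x \<noteq> 0)" if "odd p"
  proof (cases "p = 3 \<and> (\<exists>x. ?S x \<noteq> 0)")
    case True
    then obtain c where c: "?S c \<noteq> 0" by blast
    then have "c \<noteq> 0" using S0 by auto
    then have "(Emat 0 0 c (?S c), id) [^]\<^bsub>GammaL4\<^esub> p \<noteq> \<one>\<^bsub>GammaL4\<^esub>"
      unfolding Emat_pow_char[OF ch assms(1) that] GammaL4_one using True c
      by (simp add: Emat_eq_one_iff)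
    moreover have "(Emat 0 0 c (?S c), id) \<in> ?X" unfolding X by blast
    ultimately show ?thesis using big True by blast
  next
    case False
    have "x [^]\<^bsub>GammaL4\<^esub> p = \<one>\<^bsub>GammaL4\<^esub>" if "x \<in> ?X" for x
      using that False by (auto simp: X Emat_pow_char[OF ch assms(1) \<open>odd p\<close>] GammaL4_one Emat_eq_one_iff)
    then show ?thesis using small False ne by auto
  qed
  ultimately show ?thesis by blast
qed

section \<open>Constructions B and C\<close>

lemma group_exp_B:
  fixes s :: "nat \<Rightarrow> 'a::finite_field"
  assumes "params_B p l s \<mu>\<^sub>C"
  shows "group_exp (group_B p l s \<mu>\<^sub>C) \<in> {p ^ 2, p ^ 3} \<and>
    (group_exp (group_B p l s \<mu>\<^sub>C) = p ^ 3 \<longleftrightarrow>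
      p = 3 \<and> (\<exists>x\<in>subfld 3 l. lin_poly p (p * l) s x \<noteq> 0))"
proof -
  have p: "prime p" "odd p" and card: "CARD('a) = p ^ (p * l)"
    and s: "\<forall>i<p * l. s i \<in> subfld p l" and \<mu>: "\<mu>\<^sub>C \<in> subfld p l" "\<mu>\<^sub>C \<noteq> 0"
    using assms by (auto simp: params_B_def)
  let ?S = "lin_poly p (p * l) s"
  let ?k = "\<lambda>c. rep (tr p (p * l) (\<mu>\<^sub>C * c))"
  let ?X = "Gset (\<lambda>a b c. ?S c) (\<lambda>a b c. frob p l ^^ ?k c)"
  have ch: "CHAR('a) = p" using CHAR_eq_of_CARD p card by blast
  have X: "?X = {(Emat a b c (?S c), frob p l ^^ ?k c) | a b c. True}" by (simp add: Gset_def gelt_def)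
  have k: "\<not> p dvd ?k c" if "tr p (p * l) (\<mu>\<^sub>C * c) \<noteq> 0" for c
    using rep_not_dvd[OF ch tr_frob[OF ch card] that] .
  have "group_exp (GammaL4\<lparr>carrier := ?X\<rparr>) \<in> {p ^ (1 + 1), p ^ (1 + 2)} \<and>
    (group_exp (GammaL4\<lparr>carrier := ?X\<rparr>) = p ^ (1 + 2) \<longleftrightarrow> p = 3 \<and> (\<exists>y\<in>subfld 3 l. ?S y \<noteq> 0))"
  proof (rule group_exp_twisted[OF p])
    show "?X \<subseteq> twisted p l ?S" unfolding X twisted_def by blast
    obtain c where c: "tr p (p * l) (\<mu>\<^sub>C * c) \<noteq> 0" using tr_mult_nonzero[OF p(1) card \<mu>(2)] by blast
    show "\<exists>a b c k. (Emat a b c (?S c), frob p l ^^ k) \<in> ?X \<and> \<not> p dvd k \<and> rel_tr p l (p ^ 1) c \<noteq> 0"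
      using k[OF c] rel_tr_nonzero_of_tr[OF ch \<mu>(1) c] unfolding X power_one_right by blast
    assume "\<exists>y\<in>subfld p l. ?S y \<noteq> 0"
    \<comment> \<open>The automorphism and \<open>S(C)\<close> both depend on \<open>c\<close>, so a
      single \<open>c\<close> has to make both conditions hold.\<close>
    then obtain c where c: "tr p (p * l) (\<mu>\<^sub>C * c) \<noteq> 0" "?S (rel_tr p l p c) \<noteq> 0"
      using tr_and_lin_poly_rel_tr_nonzero[OF p(1) card \<mu>(2)] by blast
    show "\<exists>a b c k. (Emat a b c (?S c), frob p l ^^ k) \<in> ?X \<and> \<not> p dvd k \<and> ?S (rel_tr p l (p ^ 1) c) \<noteq> 0"
      using k[OF c(1)] c(2) unfolding X power_one_right by blast
  qed (use card s in simp_all)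
  moreover have e: "1 + 1 = (2::nat)" "1 + 2 = (3::nat)" by simp_all
  ultimately show ?thesis unfolding group_B_def e by blast
qed

lemma group_exp_C:
  fixes s :: "nat \<Rightarrow> 'a::finite_field"
  assumes "params_C p l s \<mu>\<^sub>B"
  shows "group_exp (group_C p l s \<mu>\<^sub>B) \<in> {p ^ 2, p ^ 3} \<and>
    (group_exp (group_C p l s \<mu>\<^sub>B) = p ^ 3 \<longleftrightarrow>
      p = 3 \<and> (\<exists>x\<in>subfld 3 l. lin_poly p (p * l) s x \<noteq> 0))"
proof -
  have p: "prime p" "odd p" and card: "CARD('a) = p ^ (p * l)"
    and s: "\<forall>i<p * l. s i \<in> subfld p l" and \<mu>: "\<mu>\<^sub>B \<in> subfld p l" "\<mu>\<^sub>B \<noteq> 0"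
    using assms by (auto simp: params_C_def)
  let ?S = "lin_poly p (p * l) s"
  let ?z = "\<lambda>b c. Qform p (p * l) s \<mu>\<^sub>B c / 2 + tr p (p * l) (\<mu>\<^sub>B * b)"
  let ?X = "Gset (\<lambda>a b c. ?S c) (\<lambda>a b c. frob p l ^^ rep (?z b c))"
  have ch: "CHAR('a) = p" using CHAR_eq_of_CARD p card by blast
  have X: "?X = {(Emat a b c (?S c), frob p l ^^ rep (?z b c)) | a b c. True}" by (simp add: Gset_def gelt_def)
  \<comment> \<open>Since 2 lies in the prime field, halving \<open>Qform\<close> stays in it, and
    the whole exponent is fixed by the \<open>p\<close>-th power map.\<close>
  have two: "(2 :: 'a) ^ p = 2" using power_add_char[OF ch, of 1 1 1] by simp
  have z: "?z b c ^ p = ?z b c" for b c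
    using power_add_char[OF ch, of "Qform p (p * l) s \<mu>\<^sub>B c / 2" "tr p (p * l) (\<mu>\<^sub>B * b)" 1] p(2)
    by (simp add: Qform_def power_divide two tr_frob[OF ch card])
  \<comment> \<open>For fixed \<open>c\<close> the exponents at \<open>0\<close> and at
    \<open>b\<close> differ by a nonzero trace, so one of them is nonzero. Hence \<open>c\<close>
    can be chosen first, for its relative trace alone.\<close>
  have k: "\<exists>b. \<not> p dvd rep (?z b c)" for c
  proof -
    obtain b where b: "tr p (p * l) (\<mu>\<^sub>B * b) \<noteq> 0" using tr_mult_nonzero[OF p(1) card \<mu>(2)] by blast
    have "tr p (p * l) (0 :: 'a) = 0" using additive_zero[of "tr p (p * l)"] tr_add[OF ch] by blast
    then have "?z 0 c \<noteq> 0 \<or> ?z b c \<noteq> 0" using b by auto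
    then show ?thesis using rep_not_dvd[OF ch z] by blast
  qed
  have "group_exp (GammaL4\<lparr>carrier := ?X\<rparr>) \<in> {p ^ (1 + 1), p ^ (1 + 2)} \<and>
    (group_exp (GammaL4\<lparr>carrier := ?X\<rparr>) = p ^ (1 + 2) \<longleftrightarrow> p = 3 \<and> (\<exists>y\<in>subfld 3 l. ?S y \<noteq> 0))"
  proof (rule group_exp_twisted[OF p])
    show "?X \<subseteq> twisted p l ?S" unfolding X twisted_def by blast
    obtain c :: 'a where "rel_tr p l p c \<noteq> 0" using rel_tr_nonzero[OF p(1) card] by blast
    then show "\<exists>a b c k. (Emat a b c (?S c), frob p l ^^ k) \<in> ?X \<and> \<not> p dvd k \<and> rel_tr p l (p ^ 1) c \<noteq> 0"
      using k[of c] unfolding X power_one_right by blast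
    assume "\<exists>y\<in>subfld p l. ?S y \<noteq> 0"
    then obtain c where "?S (rel_tr p l p c) \<noteq> 0" using rel_tr_onto[OF ch card] by metis
    then show "\<exists>a b c k. (Emat a b c (?S c), frob p l ^^ k) \<in> ?X \<and> \<not> p dvd k \<and> ?S (rel_tr p l (p ^ 1) c) \<noteq> 0"
      using k[of c] unfolding X power_one_right by blast
  qed (use card s in simp_all)
  moreover have e: "1 + 1 = (2::nat)" "1 + 2 = (3::nat)" by simp_all
  ultimately show ?thesis unfolding group_C_def e by blast
qed

section \<open>Construction D\<close>

text \<open>Elements of \<open>twisted\<close> have order dividing \<open>p ^ (e + 2)\<close>, so
  inverses are powers and closure under products suffices.\<close>

lemma generate_subset_twisted:
  assumes "CHAR('a::finite_field) = p" "prime p" "odd p" "\<forall>i<m. s i \<in> (subfld p l :: 'a set)"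
    and "CARD('a) = p ^ (p ^ e * l)" "e > 0" "Y \<subseteq> twisted p l (lin_poly p m s)"
  shows "generate GammaL4 Y \<subseteq> twisted p l (lin_poly p m s)"
proof
  interpret GL: group "GammaL4 :: (('a^4^4) \<times> ('a \<Rightarrow> 'a)) monoid" by (rule group_GammaL4)
  let ?W = "twisted p l (lin_poly p m s)"
  have "lin_poly p m s 0 = 0" using additive_zero[of "lin_poly p m s"] lin_poly_add[OF assms(1)] by blast
  then have one: "\<one>\<^bsub>GammaL4\<^esub> \<in> ?W"
    unfolding twisted_def GammaL4_one Emat_zero[symmetric]
    by (intro CollectI exI[of _ 0]) simp
  have pow: "x [^]\<^bsub>GammaL4\<^esub> n \<in> ?W" if "x \<in> ?W" for x and n :: nat
    by (induction n) (use one that twisted_mult[OF assms(1,4)] in auto)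
  fix x assume "x \<in> generate GammaL4 Y"
  then show "x \<in> ?W"
  proof induction
    case one
    then show ?case by (rule \<open>\<one>\<^bsub>GammaL4\<^esub> \<in> ?W\<close>)
  next
    case (incl h)
    then show ?case using assms(7) by blast
  next
    case (inv h)
    then have h: "h \<in> ?W" using assms(7) by blast
    then have hc: "h \<in> carrier GammaL4" using twisted_subset[OF assms(1)] by blast
    have "p ^ (e + 2) > 0" using assms(2) prime_gt_0_nat by simp
    then obtain N where "p ^ (e + 2) = Suc N" using gr0_conv_Suc by blast
    then have "h [^]\<^bsub>GammaL4\<^esub> N \<otimes>\<^bsub>GammaL4\<^esub> h = \<one>\<^bsub>GammaL4\<^esub>"
      using twisted_pow_eq_one(1)[OF assms(1-6) h] by simp
    then have "inv\<^bsub>GammaL4\<^esub> h = h [^]\<^bsub>GammaL4\<^esub> N" using hc by (intro GL.inv_equality) auto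
    then show ?case using pow[OF h] by simp
  next
    case (eng h1 h2)
    then show ?case using twisted_mult[OF assms(1,4)] by blast
  qed
qed

text \<open>Elements of \<open>H\<close> twist only by powers of the cube of
  \<open>frob 3 l\<close>, so a generator of the automorphism part needs a factor \<open>t\<close>.
  Products of an element of \<open>H\<close> with \<open>t\<close> reach every \<open>c\<close>
  whose trace form value equals that of \<open>t\<^sub>C\<close>; one of these has
  \<open>S(C)\<close> nonzero.\<close>

lemma group_exp_D:
  fixes s :: "nat \<Rightarrow> 'a::finite_field"
  assumes "params_D l s u t\<^sub>C \<mu>\<^sub>B \<alpha> lam"
  shows "group_exp (group_D l s u t\<^sub>C \<mu>\<^sub>B \<alpha>) \<in> {3 ^ 3, 3 ^ 4} \<and>
    (group_exp (group_D l s u t\<^sub>C \<mu>\<^sub>B \<alpha>) = 3 ^ 4 \<longleftrightarrow>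
      (\<exists>x\<in>subfld 3 l. lin_poly 3 (9 * l) s x \<noteq> 0))"
proof -
  define \<mu> where "\<mu> = u - frob 3 l u"
  let ?S = "lin_poly 3 (9 * l) s"
  let ?tr = "tr 3 (9 * l)"
  define K where "K = {z. ?tr (\<mu> * z) = 0}"
  let ?k = "\<lambda>b c. rep (Qform 3 (9 * l) s \<mu>\<^sub>B c / 2 + ?tr (\<alpha> * c + \<mu>\<^sub>B * b))"
  define H :: "(('a^4^4) \<times> ('a \<Rightarrow> 'a)) set" where "H = {(Emat a b c (?S c), (frob 3 l ^^ 3) ^^ ?k b c) | a b c. c \<in> K}"
  define t :: "('a^4^4) \<times> ('a \<Rightarrow> 'a)" where "t = (Emat 0 0 t\<^sub>C (?S t\<^sub>C), frob 3 l)"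
  let ?X = "generate GammaL4 (H \<union> {t})"
  have card9: "CARD('a) = 3 ^ (9 * l)" and \<mu>: "\<mu> \<in> subfld 3 l" "\<mu> \<noteq> 0"
    and tC: "?tr (\<mu> * t\<^sub>C) \<noteq> 0" and s: "\<forall>i<9 * l. s i \<in> subfld 3 l"
    using assms by (auto simp: params_D_def Let_def \<mu>_def)
  have card: "CARD('a) = 3 ^ (3 ^ 2 * l)" using card9 by simp
  have G: "group_D l s u t\<^sub>C \<mu>\<^sub>B \<alpha> = GammaL4\<lparr>carrier := ?X\<rparr>"
    by (simp add: group_D_def Let_def gelt_def H_def K_def t_def \<mu>_def)
  have p3: "prime (3::nat)" "odd (3::nat)" by simp_all
  have ch: "CHAR('a) = 3" using CHAR_eq_of_CARD[OF p3(1) card] .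
  have aut: "frob 3 l ^^ k \<in> (field_auts :: ('a \<Rightarrow> 'a) set)" for k by (rule frob_funpow_field_auts[OF ch])
  have tW: "(Emat a b c (?S c), frob 3 l) \<in> twisted 3 l ?S" for a b c
    unfolding twisted_def by (auto intro!: exI[of _ "Suc 0"])
  have HW: "H \<subseteq> twisted 3 l ?S" unfolding H_def twisted_def funpow_mult by blast
  have "group_exp (GammaL4\<lparr>carrier := ?X\<rparr>) \<in> {3 ^ (2 + 1), 3 ^ (2 + 2)} \<and>
    (group_exp (GammaL4\<lparr>carrier := ?X\<rparr>) = 3 ^ (2 + 2) \<longleftrightarrow> (3::nat) = 3 \<and> (\<exists>y\<in>subfld 3 l. ?S y \<noteq> 0))"
  proof (rule group_exp_twisted[OF p3 card _ s])
    show "?X \<subseteq> twisted 3 l ?S"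
      using HW tW by (intro generate_subset_twisted[OF ch p3 s card]) (auto simp: t_def)
    \<comment> \<open>For the lower exponent \<open>t\<close> itself serves: it twists by
      \<open>frob 3 l\<close>, and \<open>t\<^sub>C\<close> has nonzero relative trace.\<close>
    have "(Emat 0 0 t\<^sub>C (?S t\<^sub>C), frob 3 l ^^ 1) \<in> ?X"
      by (rule generate.incl) (simp add: t_def)
    moreover have "rel_tr 3 l (3 ^ 2) t\<^sub>C \<noteq> 0"
      using rel_tr_nonzero_of_tr[OF ch \<mu>(1), of "3 ^ 2" t\<^sub>C] tC by simp
    moreover have "\<not> 3 dvd (1::nat)" by simp
    ultimately show "\<exists>a b c k. (Emat a b c (?S c), frob 3 l ^^ k) \<in> ?X \<and> \<not> 3 dvd k \<and>
        rel_tr 3 l (3 ^ 2) c \<noteq> 0" by blast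
  next
    assume "\<exists>y\<in>subfld 3 l. ?S y \<noteq> 0"
    then obtain c0 where c0: "?tr (\<mu> * c0) \<noteq> 0" "?S (rel_tr 3 l 9 c0) \<noteq> 0"
      using tr_and_lin_poly_rel_tr_nonzero[OF p3(1) card9 \<mu>(2)] by blast
    \<comment> \<open>Nonzero traces are 1 or -1, so \<open>c0\<close> or \<open>- c0\<close> has
      the same trace form value as \<open>t\<^sub>C\<close>, and the sign does not affect whether
      \<open>S(C)\<close> vanishes.\<close>
    have unit: "z = 1 \<or> z = - 1" if "z ^ 3 = z" "z \<noteq> 0" for z :: 'a
    proof -
      have "z * ((z - 1) * (z + 1)) = 0" using that(1) by (simp add: algebra_simps power3_eq_cube)
      then show ?thesis using that(2) by (auto simp: eq_neg_iff_add_eq_0)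
    qed
    have pm: "?tr (\<mu> * c0) \<in> {1, -1}" "?tr (\<mu> * t\<^sub>C) \<in> {1, -1}"
      using unit[OF tr_frob[OF ch card9]] c0 tC by auto
    have neg: "?tr (- x) = - ?tr x" "rel_tr 3 l 9 (- x) = - rel_tr 3 l 9 x" "?S (- x) = - ?S x" for x :: 'a
      by (rule additive_uminus, simp add: tr_add[OF ch] rel_tr_add[OF ch] lin_poly_add[OF ch])+
    obtain c where c: "?tr (\<mu> * c) = ?tr (\<mu> * t\<^sub>C)" "?S (rel_tr 3 l 9 c) \<noteq> 0"
    proof (cases "?tr (\<mu> * c0) = ?tr (\<mu> * t\<^sub>C)")
      case True
      then show ?thesis using that c0 by blast
    next
      case False
      then have "?tr (\<mu> * (- c0)) = ?tr (\<mu> * t\<^sub>C)" using pm by (auto simp: neg)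
      moreover have "?S (rel_tr 3 l 9 (- c0)) \<noteq> 0" using c0 by (simp add: neg)
      ultimately show ?thesis using that by blast
    qed
    \<comment> \<open>The eighth power of \<open>frob 3 l\<close> is its inverse. It compensates for
      the twist that multiplication by \<open>t\<close> applies to the left factor; as the trace is
      invariant under Frobenius, \<open>d\<close> still lies in \<open>K\<close>.\<close>
    define d where "d = (frob 3 l ^^ 8) (c - t\<^sub>C)"
    have "frob 3 l d = (frob 3 l ^^ 9) (c - t\<^sub>C)" by (simp add: d_def numeral_eq_Suc)
    then have gd: "frob 3 l d = c - t\<^sub>C" using frob_funpow_period[OF card9] by simp
    have "\<mu> * d = (frob 3 l ^^ 8) (\<mu> * (c - t\<^sub>C))"
      using subfld_funpow[OF \<mu>(1), of 8] by (simp add: d_def frob_funpow power_mult_distrib)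
    then have "?tr (\<mu> * d) = ?tr (\<mu> * (c - t\<^sub>C))" using tr_frob_funpow[OF ch card9] by simp
    also have "\<dots> = ?tr (\<mu> * c) + ?tr (- (\<mu> * t\<^sub>C))"
      by (simp add: tr_add[OF ch, symmetric] right_diff_distrib)
    also have "\<dots> = 0" using c by (simp add: neg)
    finally have "d \<in> K" by (simp add: K_def)
    then have h: "(Emat 0 0 d (?S d), (frob 3 l ^^ 3) ^^ ?k 0 d) \<in> H" unfolding H_def by blast
    have "(Emat 0 0 d (?S d), (frob 3 l ^^ 3) ^^ ?k 0 d) \<otimes>\<^bsub>GammaL4\<^esub> t \<in> ?X"
      using h by (intro generate.eng generate.incl) auto
    moreover have "frob 3 l (?S d) + ?S t\<^sub>C = ?S c"
      using lin_poly_frob[OF ch s, of 1 d] lin_poly_add[OF ch, of "9 * l" s "c - t\<^sub>C" t\<^sub>C] gd by simp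
    \<comment> \<open>The left factor contributes a multiple of 3 to the exponent of
      \<open>frob 3 l\<close> and \<open>t\<close> contributes 1, so the product twists by a
      generator.\<close>
    then have "\<exists>a b. (Emat 0 0 d (?S d), (frob 3 l ^^ 3) ^^ ?k 0 d) \<otimes>\<^bsub>GammaL4\<^esub> t =
      (Emat a b c (?S c), frob 3 l ^^ Suc (3 * ?k 0 d))"
      using GammaL4_mult_Emat[OF aut[of 1]] gd by (auto simp: t_def funpow_mult mult.commute)
    ultimately obtain a b where "(Emat a b c (?S c), frob 3 l ^^ Suc (3 * ?k 0 d)) \<in> ?X" by metis
    moreover have "\<not> 3 dvd Suc (3 * ?k 0 d)" by presburger
    moreover have "?S (rel_tr 3 l (3 ^ 2) c) \<noteq> 0" using c(2) by simp
    ultimately show "\<exists>a b c k. (Emat a b c (?S c), frob 3 l ^^ k) \<in> ?X \<and> \<not> 3 dvd k \<and>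
        ?S (rel_tr 3 l (3 ^ 2) c) \<noteq> 0" by blast
  qed simp
  then show ?thesis unfolding G by auto
qed

theorem theorem8p3:
  shows
    "(\<forall>p m. \<forall>s :: nat \<Rightarrow> 'a::finite_field. prime p \<and> CARD('a) = p ^ m \<longrightarrow>
        group_exp (group_A p m s) \<in> {p, p ^ 2} \<and>
        (odd p \<longrightarrow>
          (group_exp (group_A p m s) = p ^ 2 \<longleftrightarrow> p = 3 \<and> (\<exists>x. lin_poly p m s x \<noteq> 0))))
   \<and> (\<forall>p l. \<forall>s :: nat \<Rightarrow> 'a. \<forall>\<mu>\<^sub>C. params_B p l s \<mu>\<^sub>C \<longrightarrow>
        group_exp (group_B p l s \<mu>\<^sub>C) \<in> {p ^ 2, p ^ 3} \<and>
        (group_exp (group_B p l s \<mu>\<^sub>C) = p ^ 3 \<longleftrightarrow>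
          p = 3 \<and> (\<exists>x\<in>subfld 3 l. lin_poly p (p * l) s x \<noteq> 0)))
   \<and> (\<forall>p l. \<forall>s :: nat \<Rightarrow> 'a. \<forall>\<mu>\<^sub>B. params_C p l s \<mu>\<^sub>B \<longrightarrow>
        group_exp (group_C p l s \<mu>\<^sub>B) \<in> {p ^ 2, p ^ 3} \<and>
        (group_exp (group_C p l s \<mu>\<^sub>B) = p ^ 3 \<longleftrightarrow>
          p = 3 \<and> (\<exists>x\<in>subfld 3 l. lin_poly p (p * l) s x \<noteq> 0)))
   \<and> (\<forall>l. \<forall>s :: nat \<Rightarrow> 'a. \<forall>u t\<^sub>C \<mu>\<^sub>B \<alpha> lam. params_D l s u t\<^sub>C \<mu>\<^sub>B \<alpha> lam \<longrightarrow>
        group_exp (group_D l s u t\<^sub>C \<mu>\<^sub>B \<alpha>) \<in> {3 ^ 3, 3 ^ 4} \<and>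
        (group_exp (group_D l s u t\<^sub>C \<mu>\<^sub>B \<alpha>) = 3 ^ 4 \<longleftrightarrow>
          (\<exists>x\<in>subfld 3 l. lin_poly 3 (9 * l) s x \<noteq> 0)))"
  using group_exp_A group_exp_B group_exp_C group_exp_D by blast

end
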